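(* Let $(X,d)$ be a complete metric space and let $f:X\to[0,\infty]$ be proper and lower semicontinuous. For $x_0\in\mathrm{dom}(f)$ and $r>0$ define $$\alpha=\alpha(x_0,r):=\inf\left\{\frac{|D^-f|(x)^2}{f(x)} : x\in B_r(x_0),\ 0<f(x)\le f(x_0)\right\}.$$ Suppose that $\alpha(x_0,r)\ge 4f(x_0)/r^2$ for some $x_0\in\mathrm{dom}(f)$ and $r>0$. For some $T\in(0,\infty]$, let $(y_t)_{t\in[0,T)}$ be a curve of maximal slope for $f$ starting at $x_0$. Then $y_T:=\lim_{t\to T}y_t$ exists, $y_t$ belongs to $\overline{B_r(x_0)}$ for all $t\in[0,T]$, and $$d(y_t,y_T)\le r\,e^{-\alpha t/2}\qquad\text{and}\qquad f(y_t)\le e^{-\alpha t}f(x_0)\qquad\text{for all } t\in[0,T],$$ where, conventionally, $e^{-\infty}:=0$.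
   Context: $B_r(x_0)$ is the open ball of radius $r$ around $x_0$ and $\overline{B_r(x_0)}$ is its closure. $\mathrm{dom}(f)=\{x: f(x)<\infty\}$, and $f$ is proper if $\mathrm{dom}(f)\ne\emptyset$. Conventions: $\inf\emptyset=+\infty$, $\infty\cdot 0=0$. Slope: $|D^-f|(x):=\limsup_{y\to x}\frac{[f(y)-f(x)]_-}{d(y,x)}$ with $a_-=\max\{-a,0\}$; by convention $|D^-f|(x)=0$ if $x\in\mathrm{dom}(f)$ is isolated and $|D^-f|(x)=+\infty$ if $x\notin\mathrm{dom}(f)$. Absolutely continuous curves: for an interval $J\subset\mathbb{R}$, $(y_t)_{t\in J}$ belongs to $AC^1_{\rm loc}(J;X)$ if there is $m:J\to\mathbb{R}$, integrable on every compact subset of $J$, with $d(y_t,y_s)\le\int_s^t m(u)\,du$ for all $s<t$ in $J$. Then the metric speed $|\dot y_t|:=\lim_{s\to t}d(y_s,y_t)/|s-t|$ exists for a.e. $t\in J$. Curve of maximal slope: $(y_t)_{t\in J}$ is a curve of maximal slope for $f$ if (a) $(y_t)_{t\in J}\in AC^1_{\rm loc}(J;X)$; (b) $(f(y_t))_{t\in J}\in AC^1_{\rm loc}(J;\mathbb{R})$; (c) $-\frac{d}{dt}f(y_t)\ge\frac12|\dot y_t|^2+\frac12|D^-f|(y_t)^2$ for a.e. $t\in J$. It starts at $x$ if $\lim_{t\downarrow\inf J}y_t=x$ (so $y_0=x$ when $J=[0,T)$). *)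

theory Defs
  imports "HOL-Analysis.Analysis"
begin

definition eff_dom :: "('a \<Rightarrow> ereal) \<Rightarrow> 'a set" where
  "eff_dom f = {x. f x < \<infinity>}"

definition proper :: "('a \<Rightarrow> ereal) \<Rightarrow> bool" where
  "proper f \<longleftrightarrow> eff_dom f \<noteq> {}"

definition lower_semicont :: "('a::topological_space \<Rightarrow> ereal) \<Rightarrow> bool" where
  "lower_semicont f \<longleftrightarrow> (\<forall>x. f x \<le> Liminf (at x) f)"

text \<open>The case distinction is needed because \<^term>\<open>Limsup\<close> along the trivial filter
  (isolated points) is \<open>-\<infinity>\<close> in \<^typ>\<open>ereal\<close>.\<close>

definition slope :: "('a::metric_space \<Rightarrow> ereal) \<Rightarrow> 'a \<Rightarrow> ereal" where
  "slope f x =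
     (if x \<notin> eff_dom f then \<infinity>
      else if open {x} then 0
      else Limsup (at x) (\<lambda>y. max (- (f y - f x)) 0 / ereal (dist y x)))"

definition AC1_loc :: "real set \<Rightarrow> (real \<Rightarrow> 'a::metric_space) \<Rightarrow> bool" where
  "AC1_loc J y \<longleftrightarrow>
     (\<exists>m::real \<Rightarrow> real.
        (\<forall>K. compact K \<and> K \<subseteq> J \<longrightarrow> m absolutely_integrable_on K) \<and>
        (\<forall>s\<in>J. \<forall>t\<in>J. s < t \<longrightarrow> dist (y t) (y s) \<le> integral {s..t} m))"

definition metric_speed :: "real set \<Rightarrow> (real \<Rightarrow> 'a::metric_space) \<Rightarrow> real \<Rightarrow> real" where
  "metric_speed J y t = Lim (at t within J) (\<lambda>s. dist (y s) (y t) / \<bar>s - t\<bar>)"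

text \<open>By local absolute continuity, the metric speed of \<open>y\<close> and the derivative of \<open>f \<circ> y\<close>
  exist almost everywhere on \<open>J\<close>, so the unspecified values of \<^const>\<open>metric_speed\<close>
  and \<^const>\<open>deriv\<close> elsewhere do not affect the differential inequality.\<close>

definition curve_of_maximal_slope ::
  "('a::metric_space \<Rightarrow> ereal) \<Rightarrow> real set \<Rightarrow> (real \<Rightarrow> 'a) \<Rightarrow> bool" where
  "curve_of_maximal_slope f J y \<longleftrightarrow>
     AC1_loc J y \<and>
     (\<forall>t\<in>J. \<bar>f (y t)\<bar> \<noteq> \<infinity>) \<and> AC1_loc J (\<lambda>t. real_of_ereal (f (y t))) \<and>
     (AE t in lebesgue. t \<in> J \<longrightarrow>
        ereal (- deriv (\<lambda>s. real_of_ereal (f (y s))) t)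
          \<ge> ereal (1/2) * ereal ((metric_speed J y t)\<^sup>2) + ereal (1/2) * (slope f (y t))\<^sup>2)"

text \<open>Limits at an end point of an interval are taken in \<^typ>\<open>ereal\<close>, so that one formula
  covers finite and infinite end points.\<close>

definition starts_at :: "real set \<Rightarrow> (real \<Rightarrow> 'a::topological_space) \<Rightarrow> 'a \<Rightarrow> bool" where
  "starts_at J y x \<longleftrightarrow>
     ((\<lambda>t::ereal. y (real_of_ereal t)) \<longlongrightarrow> x) (at_right (INF t\<in>J. ereal t))"

definition alpha :: "('a::metric_space \<Rightarrow> ereal) \<Rightarrow> 'a \<Rightarrow> real \<Rightarrow> ereal" where
  "alpha f x0 r = Inf {(slope f x)\<^sup>2 / f x | x. x \<in> ball x0 r \<and> 0 < f x \<and> f x \<le> f x0}"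

definition exp_ereal :: "ereal \<Rightarrow> ereal" where
  "exp_ereal a = (case a of ereal x \<Rightarrow> ereal (exp x) | PInfty \<Rightarrow> \<infinity> | MInfty \<Rightarrow> 0)"

text \<open>The curve \<open>y\<close> on \<open>[0,T)\<close>, extended to \<open>[0,T]\<close> by the end value \<open>yT\<close>
  (where possibly \<open>T = \<infinity>\<close>).\<close>

definition extend_end :: "ereal \<Rightarrow> 'a \<Rightarrow> (real \<Rightarrow> 'a) \<Rightarrow> ereal \<Rightarrow> 'a" where
  "extend_end T yT y t = (if t = T then yT else y (real_of_ereal t))"

end

theory Submission
  imports Defs
begin

text \<open>Write \<open>\<phi>(t) = f(y\<^sub>t)\<close>, \<open>v\<close> for the metric speed and \<open>S\<close> for the slope of \<open>f\<close> along the
  curve. The slope bounds the descent of \<open>f\<close> along the curve: \<open>- \<phi>' \<le> S v\<close> at almost every time.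
  Together with \<open>- \<phi>' \<ge> v\<^sup>2/2 + S\<^sup>2/2\<close> this forces \<open>S = v\<close> and \<open>- \<phi>' = v\<^sup>2\<close>
  (\<open>energy_identity\<close>). Let \<open>0 < c \<le> \<alpha>\<close>. As long as the curve stays in the ball and \<open>\<phi> > 0\<close>, the
  definition of \<open>\<alpha>\<close> gives \<open>v\<^sup>2 = S\<^sup>2 \<ge> c \<phi>\<close>, hence \<open>\<phi>' \<le> - c \<phi>\<close> and
  \<open>v \<le> - (2 / sqrt c) (sqrt \<phi>)'\<close>. Integration (\<open>decay_estimates\<close>) yields exponential decay of
  \<open>\<phi>\<close> and
  \<open>d(y\<^sub>s, y\<^sub>t) \<le> (2 / sqrt c) (sqrt (\<phi>(s)) - sqrt (\<phi>(t)))\<close>.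
  If moreover \<open>c \<ge> 4 f(x\<^sub>0) / r\<^sup>2\<close>, the right-hand side for \<open>s = 0\<close> is less than \<open>r\<close> while
  \<open>\<phi>(t) > 0\<close>, so the curve cannot leave the ball before \<open>\<phi>\<close> vanishes, and from that time on it is
  constant (\<open>confinement\<close>). The distance estimate is a Cauchy criterion, which gives the limit
  \<open>y\<^sub>T\<close>, and lower semicontinuity bounds \<open>f(y\<^sub>T)\<close>. For finite \<open>\<alpha>\<close> one takes \<open>c = \<alpha>\<close>; for
  \<open>\<alpha> = \<infinity>\<close> all large \<open>c\<close> are allowed, and \<open>c \<rightarrow> \<infinity>\<close> shows that \<open>\<phi>\<close> and the distance to
  \<open>y\<^sub>T\<close> vanish at positive times.

  The inequality defining a curve of maximal slope speaks about derivatives, so the argument needs that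
  \<open>\<phi>\<close> and the curve are differentiable almost everywhere, with increments controlled by the integrals of
  their derivatives. For real functions whose increments are dominated by an integral
  this follows from the Radon--Nikodym theorem and Lebesgue differentiation
  (\<open>ac_density\<close>, \<open>ac_has_derivative_AE\<close>). For curves in a metric space it is reduced to the real
  functions \<open>t \<mapsto> d(y\<^sub>t, y\<^sub>q)\<close> for countably many \<open>q\<close> (\<open>ac_metric_speed\<close>).\<close>

section \<open>Real functions with increments dominated by an integral\<close>

text \<open>Averages over right intervals \<open>[x, x + h]\<close> converge to \<open>f x\<close> almost everywhere; the same fact for the
  reflected function handles left intervals.\<close>

lemma indefinite_integral_has_derivative_AE:
  fixes f :: "real \<Rightarrow> real"
  assumes f: "f integrable_on {a..b}"
  shows "AE x in lebesgue. x \<in> {a<..<b} \<longrightarrow>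
           ((\<lambda>t. integral {a..t} f) has_real_derivative f x) (at x)"
proof -
  define F where "F x = (if x \<in> {a..b} then f x else 0)" for x
  have FU: "F integrable_on UNIV"
    using f integrable_restrict_UNIV[of "{a..b}" f] by (simp add: F_def[abs_def])
  have F: "F integrable_on cbox c d" for c d
    using integrable_on_subcbox[OF FU] by blast
  have Fr: "(\<lambda>x. F (- x)) integrable_on cbox c d" for c d
    using integrable_reflect[where f = F and a = "- d" and b = "- c"] F[of "- d" "- c"]
    by (simp del: integrable_reflect)
  obtain N1 where N1: "negligible N1"
    "\<And>x e. \<lbrakk>x \<notin> N1; 0 < e\<rbrakk> \<Longrightarrow> \<exists>d>0. \<forall>h. 0 < h \<and> h < d \<longrightarrow>
        norm (integral (cbox x (x + h *\<^sub>R One)) F /\<^sub>R h ^ DIM(real) - F x) < e"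
    using integrable_ccontinuous_explicit[of F] F by blast
  obtain N2 where N2: "negligible N2"
    "\<And>x e. \<lbrakk>x \<notin> N2; 0 < e\<rbrakk> \<Longrightarrow> \<exists>d>0. \<forall>h. 0 < h \<and> h < d \<longrightarrow>
        norm (integral (cbox x (x + h *\<^sub>R One)) (\<lambda>x. F (- x)) /\<^sub>R h ^ DIM(real) - F (- x)) < e"
    using integrable_ccontinuous_explicit[of "\<lambda>x. F (- x)"] Fr by blast
  have "negligible (uminus ` N2)"
    using N2(1)
    by (intro negligible_differentiable_image_negligible)
      (auto intro!: derivative_intros simp: differentiable_on_def)
  then have N: "negligible (N1 \<union> uminus ` N2)"
    using N1(1) by (rule negligible_Un[rotated])
  have split: "integral {a..v} f - integral {a..u} f = integral {u..v} F"
    if "a \<le> u" "u \<le> v" "v \<le> b" for u v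
  proof -
    have "integral {a..u} f + integral {u..v} f = integral {a..v} f"
      using that f by (intro Henstock_Kurzweil_Integration.integral_combine)
        (auto intro: integrable_on_subinterval)
    moreover have "integral {u..v} F = integral {u..v} f"
      using that by (intro integral_cong) (auto simp: F_def)
    ultimately show ?thesis by simp
  qed
  have "((\<lambda>t. integral {a..t} f) has_real_derivative f x) (at x)"
    if x: "x \<notin> N1 \<union> uminus ` N2" "x \<in> {a<..<b}" for x
    unfolding DERIV_def LIM_def
  proof (intro allI impI)
    fix e :: real assume e: "0 < e"
    have Fx: "F x = f x" using x by (auto simp: F_def)
    have "x \<notin> N1" "- x \<notin> N2" using x by (auto simp: image_iff)
    then obtain d1 d2 where d1: "d1 > 0" "\<And>h. 0 < h \<Longrightarrow> h < d1 \<Longrightarrow>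
        \<bar>integral {x..x + h} F / h - f x\<bar> < e"
      and d2: "d2 > 0" "\<And>h. 0 < h \<Longrightarrow> h < d2 \<Longrightarrow>
        \<bar>integral {- x..- x + h} (\<lambda>x. F (- x)) / h - f x\<bar> < e"
      using N1(2)[of x e] N2(2)[of "- x" e] e Fx by (auto simp: divide_inverse mult.commute)
    define d where "d = Min {d1, d2, x - a, b - x}"
    have d: "d > 0" "d \<le> d1" "d \<le> d2" "d \<le> x - a" "d \<le> b - x"
      using x d1 d2 by (auto simp: d_def)
    show "\<exists>s>0. \<forall>h. h \<noteq> 0 \<and> dist h 0 < s \<longrightarrow>
        dist ((integral {a..x + h} f - integral {a..x} f) / h) (f x) < e"
    proof (intro exI[of _ d] conjI allI impI d)
      fix h :: real assume h: "h \<noteq> 0 \<and> dist h 0 < d"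
      show "dist ((integral {a..x + h} f - integral {a..x} f) / h) (f x) < e"
      proof (cases "h > 0")
        case True
        with h d have "integral {a..x + h} f - integral {a..x} f = integral {x..x + h} F"
          using x by (intro split) auto
        then show ?thesis using d1(2)[of h] h d True by (auto simp: dist_real_def)
      next
        case False
        define k where "k = - h"
        have k: "0 < k" "k < d" using False h by (auto simp: k_def)
        have "integral {a..x} f - integral {a..x - k} f = integral {x - k..x} F"
          using k d x by (intro split) auto
        also have "\<dots> = integral {- x..- x + k} (\<lambda>x. F (- x))"
          using Henstock_Kurzweil_Integration.integral_reflect_real[where f = F and a = "x - k" and b = x]
          by (simp add: add.commute)
        finally have "(integral {a..x + h} f - integral {a..x} f) / h
            = integral {- x..- x + k} (\<lambda>x. F (- x)) / k"
          by (simp add: k_def divide_simps)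
        then show ?thesis using d2(2)[of k] k d by (auto simp: dist_real_def)
      qed
    qed
  qed
  then have "{x \<in> space lebesgue. \<not> (x \<in> {a<..<b} \<longrightarrow>
           ((\<lambda>t. integral {a..t} f) has_real_derivative f x) (at x))} \<subseteq> N1 \<union> uminus ` N2"
    by auto
  with N show ?thesis
    unfolding eventually_ae_filter negligible_iff_null_sets by blast
qed

lemma ac_continuous_on:
  fixes y :: "real \<Rightarrow> 'a::metric_space" and m :: "real \<Rightarrow> real"
  assumes m: "m integrable_on {a..b}"
    and y: "\<And>s t. \<lbrakk>a \<le> s; s \<le> t; t \<le> b\<rbrakk> \<Longrightarrow> dist (y t) (y s) \<le> integral {s..t} m"
  shows "continuous_on {a..b} y"
  unfolding continuous_on_iff
proof (intro ballI allI impI)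
  fix x e :: real assume x: "x \<in> {a..b}" and "0 < e"
  define M where "M t = integral {a..t} m" for t
  have M_diff: "M t - M s = integral {s..t} m" if "a \<le> s" "s \<le> t" "t \<le> b" for s t
  proof -
    have "m integrable_on {a..t}"
      using that by (intro integrable_on_subinterval[OF m]) auto
    from Henstock_Kurzweil_Integration.integral_combine[OF that(1,2) this] show ?thesis
      by (simp add: M_def)
  qed
  have "continuous_on {a..b} M"
    unfolding M_def by (intro indefinite_integral_continuous_1 m)
  with x \<open>0 < e\<close> obtain d where "d > 0" "\<forall>z\<in>{a..b}. dist z x < d \<longrightarrow> dist (M z) (M x) < e"
    unfolding continuous_on_iff by blast
  moreover have "dist (y z) (y x) \<le> dist (M z) (M x)" if "z \<in> {a..b}" for z
    using y[of x z] y[of z x] M_diff[of x z] M_diff[of z x] that x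
    by (cases "x \<le> z") (auto simp: dist_real_def dist_commute)
  ultimately show "\<exists>d>0. \<forall>z\<in>{a..b}. dist z x < d \<longrightarrow> dist (y z) (y x) < e"
    by (meson order_le_less_trans)
qed

text \<open>Domination on half-open intervals alone does not obviously pass to Borel sets, since the class of sets
  where an inequality holds is not closed under complements. With a complementary measure turning the
  inequality into an equation, uniqueness of measures applies.\<close>

lemma emeasure_le_of_add_Ioc:
  fixes M1 M2 N :: "real measure"
  assumes [simp]: "sets M1 = sets borel" "sets M2 = sets borel" "sets N = sets borel"
    and eq: "\<And>s t. s \<le> t \<Longrightarrow> emeasure M1 {s<..t} + emeasure M2 {s<..t} = emeasure N {s<..t}"
    and fin: "\<And>s t. s \<le> t \<Longrightarrow> emeasure N {s<..t} \<noteq> \<infinity>"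
  shows "emeasure M1 A \<le> emeasure N A"
proof (cases "A \<in> sets borel")
  case A: True
  define P where "P = measure_of UNIV (sets borel) (\<lambda>A. emeasure M1 A + emeasure M2 A)"
  have sP[simp]: "sets P = sets borel"
    unfolding P_def by (simp add: sets.sigma_sets_eq[of borel, simplified])
  have eP: "emeasure P B = emeasure M1 B + emeasure M2 B" if "B \<in> sets borel" for B
    unfolding P_def
  proof (rule emeasure_measure_of_sigma)
    show "sigma_algebra UNIV (sets (borel :: real measure))"
      using sets.sigma_algebra_axioms[of "borel :: real measure"] by simp
    show "positive (sets borel) (\<lambda>A. emeasure M1 A + emeasure M2 A)"
      by (simp add: positive_def)
    show "countably_additive (sets borel) (\<lambda>A. emeasure M1 A + emeasure M2 A)"
      unfolding countably_additive_def
      by (auto simp: suminf_add[symmetric] suminf_emeasure)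
  qed fact
  have "P = N"
  proof (rule measure_eqI_generator_eq)
    let ?E = "range (\<lambda>(a, b). {a<..b::real})"
    show "Int_stable ?E"
      by (auto simp: Int_stable_def)
    show "emeasure P X = emeasure N X" if "X \<in> ?E" for X
    proof -
      obtain s t where X: "X = {s<..t}" using \<open>X \<in> ?E\<close> by auto
      show ?thesis
        using eq[of s t] by (cases "s \<le> t") (auto simp: X eP)
    qed
    show "sets P = sigma_sets UNIV ?E" "sets N = sigma_sets UNIV ?E"
      by (simp_all add: borel_sigma_sets_Ioc)
    show "range (\<lambda>i::nat. {- real i<..real i}) \<subseteq> ?E"
      by auto
    show "(\<Union>i::nat. {- real i<..real i}) = UNIV"
    proof (intro equalityI subsetI UNIV_I)
      fix x :: real
      obtain n :: nat where "\<bar>x\<bar> < n" using reals_Archimedean2 by blast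
      then show "x \<in> (\<Union>i::nat. {- real i<..real i})" by (intro UN_I[of n]) auto
    qed
    show "emeasure P {- real i<..real i} \<noteq> \<infinity>" for i :: nat
      using fin[of "- real i" "real i"] by (simp add: eP eq)
  qed simp
  then show ?thesis using eP[OF A] by simp
qed (simp add: emeasure_notin_sets)

text \<open>An absolutely continuous function is the indefinite integral of a density. With \<open>K\<close> the
  indefinite integral of \<open>\<bar>m\<bar>\<close>, both \<open>K + h\<close> and \<open>K - h\<close> are nondecreasing, and their Stieltjes
  measures add up to the measure with density \<open>2 \<bar>m\<bar>\<close>. So the Stieltjes measure of
  \<open>K + h\<close> is absolutely continuous and has a Radon--Nikodym density.\<close>

lemma ac_density:
  fixes h m :: "real \<Rightarrow> real"
  assumes "a \<le> b" and m: "m absolutely_integrable_on {a..b}"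
    and h: "\<And>s t. \<lbrakk>a \<le> s; s \<le> t; t \<le> b\<rbrakk> \<Longrightarrow> \<bar>h t - h s\<bar> \<le> integral {s..t} m"
  obtains g where "g absolutely_integrable_on {a..b}"
    "\<And>s t. \<lbrakk>a \<le> s; s \<le> t; t \<le> b\<rbrakk> \<Longrightarrow> h t - h s = integral {s..t} g"
proof -
  \<comment> \<open>clamping to the interval extends everything by constants to the whole line\<close>
  define c where "c t = max a (min b t)" for t :: real
  have c: "a \<le> c t" "c t \<le> b" for t using \<open>a \<le> b\<close> by (auto simp: c_def)
  have c_mono: "c s \<le> c t" if "s \<le> t" for s t using that by (auto simp: c_def)
  have c_cont: "continuous_on UNIV c" unfolding c_def by (intro continuous_intros)
  have c_id: "c t = t" if "a \<le> t" "t \<le> b" for t using that by (auto simp: c_def)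
  have absm: "(\<lambda>x. \<bar>m x\<bar>) absolutely_integrable_on {a..b}"
    using absolutely_integrable_norm[OF m] by (simp add: comp_def)
  have absm_sub: "(\<lambda>x. \<bar>m x\<bar>) absolutely_integrable_on {s..t}"
    and m_sub: "m absolutely_integrable_on {s..t}" if "a \<le> s" "t \<le> b" for s t
    using absolutely_integrable_on_subinterval[OF absm, of s t]
      absolutely_integrable_on_subinterval[OF m, of s t] that by auto
  note io = set_lebesgue_integral_eq_integral(1)
  define K where "K t = integral {a..t} (\<lambda>x. \<bar>m x\<bar>)" for t
  have K_diff: "K t - K s = integral {s..t} (\<lambda>x. \<bar>m x\<bar>)" if "a \<le> s" "s \<le> t" "t \<le> b" for s t
    unfolding K_def
    using Henstock_Kurzweil_Integration.integral_combine[OF that(1,2) io[OF absm_sub[OF order_refl that(3)]]]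
    by simp
  have hK: "\<bar>h t - h s\<bar> \<le> K t - K s" if "a \<le> s" "s \<le> t" "t \<le> b" for s t
  proof -
    have "integral {s..t} m \<le> integral {s..t} (\<lambda>x. \<bar>m x\<bar>)"
      using that by (intro integral_le io m_sub absm_sub) auto
    with h[OF that] K_diff[OF that] show ?thesis by linarith
  qed
  have K_cont: "continuous_on {a..b} K"
    unfolding K_def by (intro indefinite_integral_continuous_1 io absm)
  have h_cont: "continuous_on {a..b} h"
    using h by (intro ac_continuous_on[OF io[OF m]]) (auto simp: dist_real_def)
  have cont: "continuous_on UNIV (\<lambda>t. K (c t))" "continuous_on UNIV (\<lambda>t. h (c t))"
    using c by (auto intro!: continuous_on_compose2[OF K_cont c_cont]
        continuous_on_compose2[OF h_cont c_cont])
  define H1 where "H1 t = K (c t) + h (c t)" for t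
  define H2 where "H2 t = K (c t) - h (c t)" for t
  have hKc: "\<bar>h (c t) - h (c s)\<bar> \<le> K (c t) - K (c s)" if "s \<le> t" for s t
    using hK[OF c(1) c_mono[OF that] c(2)] .
  have H1_mono: "H1 s \<le> H1 t" and H2_mono: "H2 s \<le> H2 t" if "s \<le> t" for s t
    using hKc[OF that] by (auto simp: H1_def H2_def)
  have H_cont: "continuous_on UNIV H1" "continuous_on UNIV H2"
    unfolding H1_def H2_def by (intro continuous_intros cont)+
  have H_rc: "continuous (at_right x) H1" "continuous (at_right x) H2" for x
    using H_cont by (auto simp: continuous_on_eq_continuous_within intro: continuous_within_subset)
  let ?m = "\<lambda>x. indicator {a..b} x * \<bar>m x\<bar>"
  have mi: "integrable lebesgue ?m"
    using absm by (simp add: set_integrable_def)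
  \<comment> \<open>a Borel representative of the dominating density, to obtain a measure on the Borel sets\<close>
  obtain m' where m'[measurable]: "m' \<in> borel_measurable lborel"
    and m'_eq0: "AE x in lborel. ?m x = m' x"
    using completion_ex_borel_measurable_real[OF borel_measurable_integrable[OF mi]] by blast
  have m'_eq: "AE x in lebesgue. ?m x = m' x"
    using m'_eq0 by (rule AE_completion)
  define N where "N = density lborel (\<lambda>x. ennreal (2 * m' x))"
  have N_Ioc: "emeasure N {s<..t} = ennreal (2 * (K (c t) - K (c s)))" if "s \<le> t" for s t
  proof -
    have "emeasure N {s<..t} = (\<integral>\<^sup>+x. ennreal (2 * m' x) * indicator {s<..t} x \<partial>lborel)"
      unfolding N_def by (subst emeasure_density) auto
    also have "\<dots> = (\<integral>\<^sup>+x. ennreal (2 * m' x) * indicator {s<..t} x \<partial>lebesgue)"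
      by (simp add: nn_integral_completion)
    also have "\<dots> = (\<integral>\<^sup>+x. ennreal (2 * (indicator {c s..c t} x *\<^sub>R \<bar>m x\<bar>)) \<partial>lebesgue)"
    proof (rule nn_integral_cong_AE)
      have "AE x in lebesgue. x \<notin> {a, s, b, c s}"
        by (intro AE_I'[of "{a, s, b, c s}"]) (auto simp: negligible_iff_null_sets[symmetric])
      with m'_eq show "AE x in lebesgue. ennreal (2 * m' x) * indicator {s<..t} x
          = ennreal (2 * (indicator {c s..c t} x *\<^sub>R \<bar>m x\<bar>))"
      proof eventually_elim
        case (elim x)
        show ?case
          unfolding elim(1)[symmetric]
          using elim(2) that \<open>a \<le> b\<close> by (auto simp: indicator_def c_def)
      qed
    qed
    also have "\<dots> = ennreal (\<integral>x. 2 * (indicator {c s..c t} x *\<^sub>R \<bar>m x\<bar>) \<partial>lebesgue)"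
      using absm_sub[of "c s" "c t"] c
      by (intro nn_integral_eq_integral) (auto simp: set_integrable_def)
    also have "(\<integral>x. 2 * (indicator {c s..c t} x *\<^sub>R \<bar>m x\<bar>) \<partial>lebesgue)
        = 2 * (LINT x:{c s..c t}|lebesgue. \<bar>m x\<bar>)"
      by (simp add: set_lebesgue_integral_def)
    also have "(LINT x:{c s..c t}|lebesgue. \<bar>m x\<bar>) = K (c t) - K (c s)"
      using K_diff[of "c s" "c t"] c c_mono[OF that] absm_sub[of "c s" "c t"]
      by (simp add: set_lebesgue_integral_eq_integral(2))
    finally show ?thesis .
  qed
  let ?M = "interval_measure H1"
  have M_Ioc: "emeasure ?M {s<..t} = ennreal (H1 t - H1 s)" if "s \<le> t" for s t
    using emeasure_interval_measure_Ioc[OF that H1_mono H_rc(1)] by simp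
  have le: "emeasure ?M A \<le> emeasure N A" for A
  proof (rule emeasure_le_of_add_Ioc)
    fix s t :: real assume st: "s \<le> t"
    have "H1 t - H1 s \<ge> 0" "H2 t - H2 s \<ge> 0" using H1_mono[OF st] H2_mono[OF st] by auto
    then show "emeasure ?M {s<..t} + emeasure (interval_measure H2) {s<..t} = emeasure N {s<..t}"
      using emeasure_interval_measure_Ioc[OF st H2_mono H_rc(2)] M_Ioc[OF st] N_Ioc[OF st]
      by (simp add: ennreal_plus[symmetric] H1_def H2_def del: ennreal_plus)
    show "emeasure N {s<..t} \<noteq> \<infinity>" using N_Ioc[OF st] by simp
  qed (auto simp: N_def)
  have "absolutely_continuous lborel ?M"
    unfolding absolutely_continuous_def
  proof
    fix A :: "real set" assume A: "A \<in> null_sets lborel"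
    then have "A \<in> null_sets N"
      unfolding N_def using absolutely_continuousI_density[of "\<lambda>x. ennreal (2 * m' x)" lborel]
      by (auto simp: absolutely_continuous_def)
    then have "emeasure ?M A = 0" using le[of A] by auto
    with A show "A \<in> null_sets ?M" by (auto simp: null_sets_def)
  qed
  then obtain u where u[measurable]: "u \<in> borel_measurable lborel" and u_dens: "density lborel u = ?M"
    using sigma_finite_measure.Radon_Nikodym[OF sigma_finite_lborel, of ?M] by auto
  have u_Ioc: "(\<integral>\<^sup>+x. u x * indicator {s<..t} x \<partial>lborel) = ennreal (H1 t - H1 s)" if "s \<le> t" for s t
    using M_Ioc[OF that] emeasure_density[OF u, of "{s<..t}"] u_dens by simp
  have u_fin: "AE x in lborel. u x * indicator {a<..b} x \<noteq> \<infinity>"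
    by (rule nn_integral_PInf_AE) (use u_Ioc[OF \<open>a \<le> b\<close>] in auto)
  define w where "w x = enn2real (u x)" for x
  have w[measurable]: "w \<in> borel_measurable lborel" unfolding w_def by measurable
  have w_int: "((\<lambda>x. w x) has_integral (H1 t - H1 s)) {s<..t}" if "a \<le> s" "s \<le> t" "t \<le> b" for s t
  proof -
    have "((\<lambda>x. indicator {s<..t} x * w x) has_integral (H1 t - H1 s)) UNIV"
    proof (rule nn_integral_has_integral)
      show "(\<lambda>x. indicator {s<..t} x * w x) \<in> borel_measurable borel"
        using w by measurable
      have "(\<integral>\<^sup>+x. ennreal (indicator {s<..t} x * w x) \<partial>lborel)
          = (\<integral>\<^sup>+x. u x * indicator {s<..t} x \<partial>lborel)"
      proof (rule nn_integral_cong_AE)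
        show "AE x in lborel. ennreal (indicator {s<..t} x * w x) = u x * indicator {s<..t} x"
          using u_fin
        proof eventually_elim
          case (elim x)
          with that show ?case
            by (auto simp: w_def indicator_def less_top[symmetric] split: if_splits)
        qed
      qed
      with u_Ioc[OF that(2)]
      show "(\<integral>\<^sup>+x. ennreal (indicator {s<..t} x * w x) \<partial>lborel) = ennreal (H1 t - H1 s)" by simp
    qed (use H1_mono[OF that(2)] in \<open>auto simp: w_def\<close>)
    moreover have "(\<lambda>x. indicator {s<..t} x * w x) = (\<lambda>x. if x \<in> {s<..t} then w x else 0)"
      by (auto simp: indicator_def)
    ultimately show ?thesis
      using has_integral_restrict_UNIV[of "{s<..t}" w "H1 t - H1 s"] by simp
  qed
  have w_int': "(w has_integral (H1 t - H1 s)) {s..t}" if "a \<le> s" "s \<le> t" "t \<le> b" for s t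
    using w_int[OF that]
    by (rule has_integral_spike_set_eq[THEN iffD1, rotated -1])
       (auto intro: negligible_subset[of "{s}"])
  have w_abs: "w absolutely_integrable_on {a..b}"
    using w_int'[of a b] \<open>a \<le> b\<close>
    by (intro nonnegative_absolutely_integrable_1) (auto simp: w_def)
  show ?thesis
  proof (rule that)
    \<comment> \<open>the density of the Stieltjes measure of \<open>K + h\<close> minus the one of \<open>K\<close>\<close>
    show "(\<lambda>x. w x - \<bar>m x\<bar>) absolutely_integrable_on {a..b}"
      using w_abs absm by (rule set_integral_diff)
    fix s t assume st: "a \<le> s" "s \<le> t" "t \<le> b"
    have "integral {s..t} (\<lambda>x. w x - \<bar>m x\<bar>) = (H1 t - H1 s) - (K t - K s)"
      using w_int'[OF st] absm_sub[OF st(1,3)] K_diff[OF st]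
      by (subst integral_diff) (auto intro: io simp: integral_unique integrable_on_def)
    then show "h t - h s = integral {s..t} (\<lambda>x. w x - \<bar>m x\<bar>)"
      using st by (simp add: H1_def c_id)
  qed
qed

lemma integral_le_AE:
  fixes f g :: "real \<Rightarrow> real"
  assumes f: "f integrable_on {s..t}" and g: "g integrable_on {s..t}"
    and le: "AE x in lebesgue. x \<in> {s<..<t} \<longrightarrow> f x \<le> g x"
  shows "integral {s..t} f \<le> integral {s..t} g"
proof -
  obtain N where N: "N \<in> null_sets lebesgue"
    "{x \<in> space lebesgue. \<not> (x \<in> {s<..<t} \<longrightarrow> f x \<le> g x)} \<subseteq> N"
    using le unfolding eventually_ae_filter by blast
  have neg: "negligible (N \<union> {s, t})"
    using N(1) by (auto simp: negligible_iff_null_sets[symmetric] intro: negligible_Un)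
  have eq: "min (f x) (g x) = f x" if "x \<in> {s..t} - (N \<union> {s, t})" for x
    using that N(2) by (force simp: min_def)
  have "integral {s..t} f = integral {s..t} (\<lambda>x. min (f x) (g x))"
    by (rule integral_spike[OF neg eq])
  also have "\<dots> \<le> integral {s..t} g"
    by (intro integral_le integrable_spike[OF f neg eq] g) auto
  finally show ?thesis .
qed

lemma ac_has_derivative_AE:
  fixes h m :: "real \<Rightarrow> real"
  assumes "a \<le> b" and m: "m absolutely_integrable_on {a..b}"
    and h: "\<And>s t. \<lbrakk>a \<le> s; s \<le> t; t \<le> b\<rbrakk> \<Longrightarrow> \<bar>h t - h s\<bar> \<le> integral {s..t} m"
  obtains g where "g absolutely_integrable_on {a..b}"
    "\<forall>s t. a \<le> s \<and> s \<le> t \<and> t \<le> b \<longrightarrow> h t - h s = integral {s..t} g"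
    "AE t in lebesgue. t \<in> {a<..<b} \<longrightarrow> (h has_real_derivative g t) (at t)"
proof -
  obtain g where g: "g absolutely_integrable_on {a..b}"
    "\<And>s t. \<lbrakk>a \<le> s; s \<le> t; t \<le> b\<rbrakk> \<Longrightarrow> h t - h s = integral {s..t} g"
    using ac_density[OF assms] by blast
  have "AE t in lebesgue. t \<in> {a<..<b} \<longrightarrow>
      ((\<lambda>t. integral {a..t} g) has_real_derivative g t) (at t)"
    by (intro indefinite_integral_has_derivative_AE set_lebesgue_integral_eq_integral(1) g)
  then have "AE t in lebesgue. t \<in> {a<..<b} \<longrightarrow> (h has_real_derivative g t) (at t)"
  proof eventually_elim
    case (elim t)
    show ?case
    proof
      assume t: "t \<in> {a<..<b}"
      then have "((\<lambda>t. h a + integral {a..t} g) has_real_derivative g t) (at t)"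
        using elim by (auto intro!: derivative_eq_intros)
      then show "(h has_real_derivative g t) (at t)"
      proof (rule has_field_derivative_transform_within_open)
        show "h a + integral {a..x} g = h x" if "x \<in> {a<..<b}" for x
          using g(2)[of a x] that by simp
      qed (use t in auto)
    qed
  qed
  with g show ?thesis by (intro that[of g]) auto
qed

lemma ac_nonincreasing:
  fixes h m :: "real \<Rightarrow> real"
  assumes "a \<le> b" and m: "m absolutely_integrable_on {a..b}"
    and h: "\<And>s t. \<lbrakk>a \<le> s; s \<le> t; t \<le> b\<rbrakk> \<Longrightarrow> \<bar>h t - h s\<bar> \<le> integral {s..t} m"
    and D: "AE t in lebesgue. t \<in> {a<..<b} \<longrightarrow> (\<exists>D\<le>0. (h has_real_derivative D) (at t))"
  shows "h b \<le> h a"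
proof -
  obtain g where g: "g absolutely_integrable_on {a..b}"
    "\<forall>s t. a \<le> s \<and> s \<le> t \<and> t \<le> b \<longrightarrow> h t - h s = integral {s..t} g"
    "AE t in lebesgue. t \<in> {a<..<b} \<longrightarrow> (h has_real_derivative g t) (at t)"
    by (rule ac_has_derivative_AE[OF assms(1-3)])
  have "AE t in lebesgue. t \<in> {a<..<b} \<longrightarrow> g t \<le> 0"
    using g(3) D by eventually_elim (auto dest: DERIV_unique)
  then have "integral {a..b} g \<le> integral {a..b} (\<lambda>_. 0)"
    by (intro integral_le_AE set_lebesgue_integral_eq_integral(1) g) auto
  with g(2) \<open>a \<le> b\<close> show ?thesis by force
qed

section \<open>The metric speed of an absolutely continuous curve\<close>

text \<open>The metric speed is the supremum of \<open>\<bar>d/dt d(y\<^sub>t, y\<^sub>q)\<bar>\<close> over a countable dense set of times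
  \<open>q\<close>. Each of these functions has difference quotients bounded by those of \<open>y\<close>, which gives the lower
  bound on the limit; integrating and letting \<open>q\<close> tend to \<open>s\<close> bounds \<open>d(y\<^sub>s, y\<^sub>t)\<close>
  by the integral of the supremum, and Lebesgue differentiation gives the upper bound.\<close>

lemma ac_metric_speed:
  fixes y :: "real \<Rightarrow> 'a::metric_space" and m :: "real \<Rightarrow> real"
  assumes "a \<le> b" and m: "m absolutely_integrable_on {a..b}"
    and y: "\<And>s t. \<lbrakk>a \<le> s; s \<le> t; t \<le> b\<rbrakk> \<Longrightarrow> dist (y t) (y s) \<le> integral {s..t} m"
  obtains v where "v absolutely_integrable_on {a..b}"
    "\<And>s t. \<lbrakk>a \<le> s; s \<le> t; t \<le> b\<rbrakk> \<Longrightarrow> dist (y t) (y s) \<le> integral {s..t} v"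
    "AE t in lebesgue. t \<in> {a<..<b} \<longrightarrow> ((\<lambda>s. dist (y s) (y t) / \<bar>s - t\<bar>) \<longlongrightarrow> v t) (at t)"
proof -
  note io = set_lebesgue_integral_eq_integral(1)
  define Q where "Q = insert a (\<rat> \<inter> {a..b})"
  have Q: "countable Q" "Q \<noteq> {}" "Q \<subseteq> {a..b}"
    using \<open>a \<le> b\<close> by (auto simp: Q_def countable_rat)
  have \<phi>_ac: "\<bar>dist (y t) (y q) - dist (y s) (y q)\<bar> \<le> integral {s..t} m"
    if "a \<le> s" "s \<le> t" "t \<le> b" for q s t
    using y[OF that] by (smt (verit) dist_commute dist_triangle)
  have "\<forall>q. \<exists>g. g absolutely_integrable_on {a..b} \<and>
      (\<forall>s t. a \<le> s \<and> s \<le> t \<and> t \<le> b \<longrightarrow>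
        dist (y t) (y q) - dist (y s) (y q) = integral {s..t} g) \<and>
      (AE t in lebesgue. t \<in> {a<..<b} \<longrightarrow> ((\<lambda>t. dist (y t) (y q)) has_real_derivative g t) (at t))"
    (is "\<forall>q. \<exists>g. ?P q g")
  proof
    show "\<exists>g. ?P q g" for q
      by (rule ac_has_derivative_AE[OF \<open>a \<le> b\<close> m \<phi>_ac[where q = q]]) auto
  qed
  from choice[OF this] obtain G where PG: "\<forall>q. ?P q (G q)" ..
  have G: "G q absolutely_integrable_on {a..b}"
    "a \<le> s \<and> s \<le> t \<and> t \<le> b \<Longrightarrow> dist (y t) (y q) - dist (y s) (y q) = integral {s..t} (G q)"
    "AE t in lebesgue. t \<in> {a<..<b} \<longrightarrow> ((\<lambda>t. dist (y t) (y q)) has_real_derivative G q t) (at t)"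
    for q s t
    using PG by simp_all
  define M where "M t = integral {a..t} m" for t
  have M_diff: "M t - M s = integral {s..t} m" if "a \<le> s" "s \<le> t" "t \<le> b" for s t
    unfolding M_def
    using Henstock_Kurzweil_Integration.integral_combine[OF that(1,2)]
      io[OF absolutely_integrable_on_subinterval[OF m, of a t]] that by fastforce
  have M': "AE t in lebesgue. t \<in> {a<..<b} \<longrightarrow> (M has_real_derivative m t) (at t)"
    unfolding M_def[abs_def] by (intro indefinite_integral_has_derivative_AE io m)
  have G_all: "AE t in lebesgue. \<forall>q\<in>Q. t \<in> {a<..<b} \<longrightarrow>
      ((\<lambda>t. dist (y t) (y q)) has_real_derivative G q t) (at t)"
    unfolding AE_ball_countable[OF Q(1)] by (intro ballI G(3))
  have G_le: "AE t in lebesgue. t \<in> {a<..<b} \<longrightarrow> (\<forall>q\<in>Q. \<bar>G q t\<bar> \<le> m t)"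
    using M' G_all
  proof eventually_elim
    case (elim t)
    show ?case
    proof (intro impI ballI)
      fix q assume t: "t \<in> {a<..<b}" and q: "q \<in> Q"
      have "((\<lambda>t. M t - dist (y t) (y q)) has_real_derivative m t - G q t) (at t)"
        "((\<lambda>t. M t + dist (y t) (y q)) has_real_derivative m t + G q t) (at t)"
        using elim t q by (auto intro!: derivative_eq_intros)
      moreover have "mono_on {a..b} (\<lambda>t. M t - dist (y t) (y q))"
        "mono_on {a..b} (\<lambda>t. M t + dist (y t) (y q))"
        using \<phi>_ac[where q = q] M_diff by (auto intro!: mono_onI) (smt (verit))+
      ultimately have "m t - G q t \<ge> 0" "m t + G q t \<ge> 0"
        using t by (auto dest!: mono_on_imp_deriv_nonneg)
      then show "\<bar>G q t\<bar> \<le> m t" by linarith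
    qed
  qed
  \<comment> \<open>Truncation by \<open>\<bar>m\<bar>\<close> makes the supremum finite everywhere; by \<open>G_le\<close> it has no effect almost everywhere.\<close>
  define v where "v t = (SUP q\<in>Q. min \<bar>G q t\<bar> \<bar>m t\<bar>)" for t
  have bdd: "bdd_above ((\<lambda>q. min \<bar>G q t\<bar> \<bar>m t\<bar>) ` Q)" for t
    by (intro bdd_aboveI2[of _ _ "\<bar>m t\<bar>"]) auto
  have v_ge: "min \<bar>G q t\<bar> \<bar>m t\<bar> \<le> v t" if "q \<in> Q" for q t
    unfolding v_def by (rule cSUP_upper[OF that bdd])
  have v_le: "v t \<le> \<bar>m t\<bar>" for t
    unfolding v_def by (intro cSUP_least Q) auto
  have v_nonneg: "v t \<ge> 0" for t
    using v_ge[of a t] by (auto simp: Q_def)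
  have v_abs: "v absolutely_integrable_on {a..b}"
  proof (rule measurable_bounded_by_integrable_imp_absolutely_integrable)
    have [measurable]: "G q \<in> borel_measurable (lebesgue_on {a..b})"
      "m \<in> borel_measurable (lebesgue_on {a..b})" for q
      by (intro integrable_imp_measurable io G m)+
    show "v \<in> borel_measurable (lebesgue_on {a..b})"
      unfolding v_def[abs_def] using Q(1) bdd by (intro borel_measurable_cSUP) measurable
    show "(\<lambda>t. \<bar>m t\<bar>) integrable_on {a..b}"
      using m by (simp add: absolutely_integrable_on_def)
  qed (use v_nonneg v_le in auto)
  have v_sub: "v integrable_on {s..t}" "G q integrable_on {s..t}" if "a \<le> s" "t \<le> b" for s t q
    using that by (auto intro!: io absolutely_integrable_on_subinterval[OF v_abs]
        absolutely_integrable_on_subinterval[OF G(1)])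
  have dist_q: "dist (y t) (y q) - dist (y s) (y q) \<le> integral {s..t} v"
    if "a \<le> s" "s \<le> t" "t \<le> b" "q \<in> Q" for s t q
  proof -
    have "AE x in lebesgue. x \<in> {s<..<t} \<longrightarrow> G q x \<le> v x"
      using G_le
    proof eventually_elim
      case (elim x)
      with that v_ge[OF that(4), of x] show ?case by force
    qed
    with v_sub[OF that(1,3)] have "integral {s..t} (G q) \<le> integral {s..t} v"
      by (intro integral_le_AE)
    with G(2)[of s t q] that show ?thesis by simp
  qed
  have y_cont: "\<exists>d>0. \<forall>q\<in>{a..b}. dist q s < d \<longrightarrow> dist (y q) (y s) < e"
    if "s \<in> {a..b}" "e > 0" for s e
    using ac_continuous_on[OF io[OF m] y] that unfolding continuous_on_iff by blast
  have dist_v: "dist (y t) (y s) \<le> integral {s..t} v" if "a \<le> s" "s \<le> t" "t \<le> b" for s t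
  proof (cases "s = t")
    case False
    show ?thesis
    proof (rule field_le_epsilon)
      fix e :: real assume "0 < e"
      have "s \<in> {a..b}" using that by simp
      from y_cont[OF this half_gt_zero[OF \<open>0 < e\<close>]]
      obtain d where d: "d > 0" "\<forall>q\<in>{a..b}. dist q s < d \<longrightarrow> dist (y q) (y s) < e / 2"
        by blast
      obtain q where q: "q \<in> \<rat>" "s < q" "q < min (s + d) t"
        using Rats_dense_in_real[of s "min (s + d) t"] d(1) False \<open>s \<le> t\<close>
        by (metis less_add_same_cancel1 min_less_iff_conj order_le_less)
      then have "q \<in> Q" "dist (y q) (y s) < e / 2"
        using that d(2) by (auto simp: Q_def dist_real_def)
      then show "dist (y t) (y s) \<le> integral {s..t} v + e"
        using dist_q[OF that, of q] dist_triangle[of "y t" "y s" "y q"] dist_commute[of "y s" "y q"]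
        by linarith
    qed
  qed auto
  have v': "AE t in lebesgue. t \<in> {a<..<b} \<longrightarrow>
      ((\<lambda>t. integral {a..t} v) has_real_derivative v t) (at t)"
    by (intro indefinite_integral_has_derivative_AE io v_abs)
  have "AE t in lebesgue. t \<in> {a<..<b} \<longrightarrow>
      ((\<lambda>s. dist (y s) (y t) / \<bar>s - t\<bar>) \<longlongrightarrow> v t) (at t)"
    using v' G_le G_all
  proof eventually_elim
    case (elim t)
    show ?case
    proof
      assume t: "t \<in> {a<..<b}"
      let ?I = "\<lambda>t. integral {a..t} v"
      have lim_v: "((\<lambda>s. (?I s - ?I t) / (s - t)) \<longlongrightarrow> v t) (at t)"
        using elim t by (simp add: has_field_derivative_iff)
      have near: "eventually (\<lambda>s. s \<in> {a<..<b} \<and> s \<noteq> t) (at t)"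
        using t by (intro eventually_conj eventually_at_in_open' eventually_neq_at_within) auto
      have upper: "dist (y s) (y t) / \<bar>s - t\<bar> \<le> (?I s - ?I t) / (s - t)"
        if "s \<in> {a<..<b} \<and> s \<noteq> t" for s
      proof (cases "s < t")
        case True
        then have "dist (y s) (y t) \<le> ?I t - ?I s"
          using dist_v[of s t] that t
            Henstock_Kurzweil_Integration.integral_combine[of a s t v] v_sub[of a t]
          by (simp add: dist_commute)
        then have "dist (y s) (y t) / (t - s) \<le> (?I t - ?I s) / (t - s)"
          using True by (intro divide_right_mono) auto
        also have "\<dots> = (?I s - ?I t) / (s - t)"
          by (metis minus_diff_eq minus_divide_divide)
        finally show ?thesis using True by simp
      next
        case False
        then have "dist (y s) (y t) \<le> ?I s - ?I t"
          using dist_v[of t s] that t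
            Henstock_Kurzweil_Integration.integral_combine[of a t s v] v_sub[of a s]
          by simp
        then show ?thesis using False by (simp add: divide_right_mono)
      qed
      show "((\<lambda>s. dist (y s) (y t) / \<bar>s - t\<bar>) \<longlongrightarrow> v t) (at t)"
      proof (rule order_tendstoI)
        fix c assume "c > v t"
        then have "eventually (\<lambda>s. (?I s - ?I t) / (s - t) < c) (at t)"
          using lim_v by (simp add: order_tendsto_iff)
        with near show "eventually (\<lambda>s. dist (y s) (y t) / \<bar>s - t\<bar> < c) (at t)"
          by eventually_elim (use upper in force)
      next
        fix c assume "c < v t"
        then obtain q where q: "q \<in> Q" "c < \<bar>G q t\<bar>"
          unfolding v_def using less_cSUP_iff[OF Q(2) bdd, of c] by auto
        have "((\<lambda>s. \<bar>(dist (y s) (y q) - dist (y t) (y q)) / (s - t)\<bar>) \<longlongrightarrow> \<bar>G q t\<bar>) (at t)"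
          using elim t q by (intro tendsto_rabs) (auto simp: has_field_derivative_iff)
        then have "eventually (\<lambda>s. c < \<bar>(dist (y s) (y q) - dist (y t) (y q)) / (s - t)\<bar>) (at t)"
          using q by (simp add: order_tendsto_iff)
        then show "eventually (\<lambda>s. c < dist (y s) (y t) / \<bar>s - t\<bar>) (at t)"
        proof eventually_elim
          case (elim s)
          have "\<bar>dist (y s) (y q) - dist (y t) (y q)\<bar> \<le> dist (y s) (y t)"
            by (smt (verit) dist_commute dist_triangle)
          then have "\<bar>(dist (y s) (y q) - dist (y t) (y q)) / (s - t)\<bar> \<le> dist (y s) (y t) / \<bar>s - t\<bar>"
            by (simp add: divide_right_mono)
          with elim show ?case by linarith
        qed
      qed
    qed
  qed
  with v_abs dist_v show ?thesis by (rule that)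
qed

section \<open>Slope and metric speed\<close>

lemma slope_nonneg: "0 \<le> slope f x"
proof (cases "x \<in> eff_dom f \<and> \<not> open {x}")
  case True
  then have "at x \<noteq> bot" by (simp add: at_eq_bot_iff)
  moreover have "0 \<le> Liminf (at x) (\<lambda>y. max (- (f y - f x)) 0 / ereal (dist y x))"
    by (intro Liminf_bounded always_eventually allI zero_le_divide_ereal) auto
  ultimately have "0 \<le> Limsup (at x) (\<lambda>y. max (- (f y - f x)) 0 / ereal (dist y x))"
    using Liminf_le_Limsup order_trans by blast
  with True show ?thesis by (simp add: slope_def)
qed (auto simp: slope_def)

text \<open>The descending slope is a weak upper gradient: only decreasing directions need to be controlled.
  If \<open>D < 0\<close>, then \<open>f(y\<^sub>s) < f(y\<^sub>t)\<close> for \<open>s > t\<close> close to \<open>t\<close>, so \<open>y\<^sub>s \<noteq> y\<^sub>t\<close> and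
  the descent of \<open>f\<close> from \<open>y\<^sub>t\<close> to \<open>y\<^sub>s\<close> is one of the quotients in the definition of the slope.\<close>

lemma neg_deriv_le_slope_mult_speed:
  fixes f :: "'a::metric_space \<Rightarrow> ereal" and y :: "real \<Rightarrow> 'a"
  defines "\<phi> \<equiv> \<lambda>s. real_of_ereal (f (y s))"
  assumes fin: "eventually (\<lambda>s. \<bar>f (y s)\<bar> \<noteq> \<infinity>) (at t)" "\<bar>f (y t)\<bar> \<noteq> \<infinity>"
    and D: "(\<phi> has_real_derivative D) (at t)"
    and v: "((\<lambda>s. dist (y s) (y t) / \<bar>s - t\<bar>) \<longlongrightarrow> v) (at t)"
    and S: "slope f (y t) = ereal S"
  shows "- D \<le> S * v"
proof (cases "D < 0")
  case False
  have "0 \<le> v" by (rule tendsto_lowerbound[OF v]) auto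
  moreover have "0 \<le> S" using slope_nonneg[of f "y t"] S by simp
  ultimately have "0 \<le> S * v" by simp
  with False show ?thesis by linarith
next
  case True
  have R: "at_right t \<le> at t" by (simp add: at_le)
  have quot: "((\<lambda>s. (\<phi> s - \<phi> t) / (s - t)) \<longlongrightarrow> D) (at_right t)"
    using D R unfolding has_field_derivative_iff by (rule tendsto_mono[rotated])
  have v_right: "((\<lambda>s. dist (y s) (y t) / (s - t)) \<longlongrightarrow> v) (at_right t)"
  proof (rule Lim_transform_eventually)
    show "((\<lambda>s. dist (y s) (y t) / \<bar>s - t\<bar>) \<longlongrightarrow> v) (at_right t)"
      using v R by (rule tendsto_mono[rotated])
    show "eventually (\<lambda>s. dist (y s) (y t) / \<bar>s - t\<bar> = dist (y s) (y t) / (s - t)) (at_right t)"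
      by (auto simp: eventually_at_right_less intro: eventually_mono[OF eventually_at_right_less])
  qed
  have dec: "eventually (\<lambda>s. \<phi> s < \<phi> t \<and> t < s \<and> \<bar>f (y s)\<bar> \<noteq> \<infinity>) (at_right t)"
  proof -
    have "eventually (\<lambda>s. (\<phi> s - \<phi> t) / (s - t) < 0) (at_right t)"
      using quot True by (simp add: order_tendsto_iff)
    moreover have "eventually (\<lambda>s. t < s) (at_right t)" by (rule eventually_at_right_less)
    moreover have "eventually (\<lambda>s. \<bar>f (y s)\<bar> \<noteq> \<infinity>) (at_right t)"
      using fin(1) R by (rule filter_leD[rotated])
    ultimately show ?thesis
      by eventually_elim (auto simp: divide_less_0_iff)
  qed
  have lim: "filterlim y (at (y t)) (at_right t)"
    unfolding filterlim_at
  proof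
    show "eventually (\<lambda>s. y s \<in> UNIV \<and> y s \<noteq> y t) (at_right t)"
      using dec by eventually_elim (auto simp: \<phi>_def)
    \<comment> \<open>existence of a finite speed implies continuity at \<open>t\<close>\<close>
    have "((\<lambda>s. dist (y s) (y t) / (s - t) * (s - t)) \<longlongrightarrow> v * (t - t)) (at_right t)"
      by (intro tendsto_intros v_right)
    then have "((\<lambda>s. dist (y s) (y t) / (s - t) * (s - t)) \<longlongrightarrow> 0) (at_right t)" by simp
    then have "((\<lambda>s. dist (y s) (y t)) \<longlongrightarrow> 0) (at_right t)"
      by (rule Lim_transform_eventually)
        (auto intro: eventually_mono[OF eventually_at_right_less])
    then show "(y \<longlongrightarrow> y t) (at_right t)" by (rule tendsto_dist_iff[THEN iffD2])
  qed
  have "\<not> open {y t}"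
  proof
    assume "open {y t}"
    then have "at (y t) = bot" by (simp add: at_eq_bot_iff)
    then have "eventually (\<lambda>_. False) (at (y t))" by simp
    from eventually_compose_filterlim[OF this lim] show False by simp
  qed
  moreover have "y t \<in> eff_dom f" using fin(2) by (auto simp: eff_dom_def)
  ultimately have Limsup: "Limsup (at (y t)) (\<lambda>z. max (- (f z - f (y t))) 0 / ereal (dist z (y t))) = ereal S"
    using S by (simp add: slope_def)
  have bound: "- D \<le> (S + e) * v" if "e > 0" for e
  proof (rule tendsto_le)
    show "((\<lambda>s. (S + e) * (dist (y s) (y t) / (s - t))) \<longlongrightarrow> (S + e) * v) (at_right t)"
      by (intro tendsto_intros v_right)
    show "((\<lambda>s. - ((\<phi> s - \<phi> t) / (s - t))) \<longlongrightarrow> - D) (at_right t)"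
      by (intro tendsto_intros quot)
    have "eventually (\<lambda>z. max (- (f z - f (y t))) 0 / ereal (dist z (y t)) < ereal (S + e)) (at (y t))"
      using Limsup that by (intro Limsup_lessD) auto
    then have "eventually (\<lambda>s. max (- (f (y s) - f (y t))) 0 / ereal (dist (y s) (y t)) < ereal (S + e))
        (at_right t)"
      using lim by (rule eventually_compose_filterlim)
    with dec show "eventually (\<lambda>s. - ((\<phi> s - \<phi> t) / (s - t)) \<le> (S + e) * (dist (y s) (y t) / (s - t)))
        (at_right t)"
    proof eventually_elim
      case (elim s)
      then have f: "f (y s) = ereal (\<phi> s)" "f (y t) = ereal (\<phi> t)"
        using fin(2) by (auto simp: \<phi>_def ereal_real)
      have d: "dist (y s) (y t) > 0" using elim by (auto simp: \<phi>_def)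
      have "max (- (f (y s) - f (y t))) 0 = ereal (\<phi> t - \<phi> s)"
        using elim by (simp add: f max_def)
      with elim d have "(\<phi> t - \<phi> s) / dist (y s) (y t) < S + e" by simp
      with d have "\<phi> t - \<phi> s \<le> (S + e) * dist (y s) (y t)" by (simp add: divide_less_eq)
      then have "(\<phi> t - \<phi> s) / (s - t) \<le> (S + e) * dist (y s) (y t) / (s - t)"
        using elim by (intro divide_right_mono) auto
      then show ?case by (simp add: minus_divide_left)
    qed
  qed simp
  have "((\<lambda>e. (S + e) * v) \<longlongrightarrow> (S + 0) * v) (at_right 0)"
    by (intro tendsto_intros)
  then show ?thesis
    using bound by (intro tendsto_lowerbound[of _ _ "at_right 0"])
      (auto intro: eventually_mono[OF eventually_at_right_less])
qed

text \<open>Equality holds in Young's inequality \<open>S v \<le> v\<^sup>2/2 + S\<^sup>2/2\<close>, so speed and slope agree.\<close>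

lemma energy_identity:
  fixes f :: "'a::metric_space \<Rightarrow> ereal" and y :: "real \<Rightarrow> 'a"
  defines "\<phi> \<equiv> \<lambda>s. real_of_ereal (f (y s))"
  assumes fin: "eventually (\<lambda>s. \<bar>f (y s)\<bar> \<noteq> \<infinity>) (at t)" "\<bar>f (y t)\<bar> \<noteq> \<infinity>"
    and D: "(\<phi> has_real_derivative D) (at t)"
    and v: "((\<lambda>s. dist (y s) (y t) / \<bar>s - t\<bar>) \<longlongrightarrow> v) (at t)"
    and ineq: "ereal (1/2) * ereal (v\<^sup>2) + ereal (1/2) * (slope f (y t))\<^sup>2 \<le> ereal (- D)"
  shows "slope f (y t) = ereal v" "D = - v\<^sup>2"
proof -
  have "slope f (y t) \<noteq> \<infinity>" using ineq by (auto simp: power2_eq_square)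
  then obtain S where S: "slope f (y t) = ereal S"
    using slope_nonneg[of f "y t"] by (cases "slope f (y t)") auto
  have "- D \<le> S * v"
    using neg_deriv_le_slope_mult_speed[OF fin _ v S] D by (simp add: \<phi>_def)
  moreover have *: "v\<^sup>2 / 2 + S\<^sup>2 / 2 \<le> - D" using ineq by (simp add: S power2_eq_square)
  ultimately have "(v - S)\<^sup>2 \<le> 0" by (simp add: power2_diff mult.commute)
  then have "v = S" by simp
  with S show "slope f (y t) = ereal v" by simp
  show "D = - v\<^sup>2" using * \<open>v = S\<close> \<open>- D \<le> S * v\<close> by (simp add: power2_eq_square)
qed

section \<open>Energy decay and confinement to the ball\<close>

text \<open>Here \<open>w\<close> plays the role of the speed. The hypotheses say \<open>\<phi>' = - w\<^sup>2\<close> and \<open>w \<ge> sqrt (c \<phi>)\<close>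
  almost everywhere. The lower bound \<open>p\<close> makes \<open>sqrt\<close> and \<open>ln\<close> Lipschitz on the range of
  \<open>\<phi>\<close>, so that compositions with them remain absolutely continuous.\<close>

lemma decay_estimates:
  fixes \<phi> w m :: "real \<Rightarrow> real"
  assumes ab: "a \<le> b" and c: "0 < c"
    and m: "m absolutely_integrable_on {a..b}"
    and ac: "\<And>s t. \<lbrakk>a \<le> s; s \<le> t; t \<le> b\<rbrakk> \<Longrightarrow> \<bar>\<phi> t - \<phi> s\<bar> \<le> integral {s..t} m"
    and w: "w absolutely_integrable_on {a..b}"
    and pos: "0 < p" "\<And>t. t \<in> {a..b} \<Longrightarrow> p \<le> \<phi> t"
    and deriv: "AE t in lebesgue. t \<in> {a<..<b} \<longrightarrow>
        (\<phi> has_real_derivative - (w t)\<^sup>2) (at t) \<and> 0 \<le> w t \<and> c * \<phi> t \<le> (w t)\<^sup>2"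
  shows "integral {a..b} w \<le> 2 / sqrt c * (sqrt (\<phi> a) - sqrt (\<phi> b))"
    and "\<phi> b \<le> exp (- (c * (b - a))) * \<phi> a"
proof -
  note io = set_lebesgue_integral_eq_integral(1)
  have m_sub: "m absolutely_integrable_on {s..t}" and w_sub: "w absolutely_integrable_on {s..t}"
    and w_abs_sub: "(\<lambda>x. \<bar>w x\<bar>) absolutely_integrable_on {s..t}" if "a \<le> s" "t \<le> b" for s t
  proof -
    show "m absolutely_integrable_on {s..t}" "w absolutely_integrable_on {s..t}"
      using that by (auto intro: absolutely_integrable_on_subinterval[OF m]
          absolutely_integrable_on_subinterval[OF w])
    from absolutely_integrable_norm[OF this(2)]
    show "(\<lambda>x. \<bar>w x\<bar>) absolutely_integrable_on {s..t}" by (simp add: comp_def)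
  qed
  define I where "I t = integral {a..t} w" for t
  have I_diff: "I t - I s = integral {s..t} w" if "a \<le> s" "s \<le> t" "t \<le> b" for s t
    unfolding I_def
    using Henstock_Kurzweil_Integration.integral_combine[OF that(1,2) io[OF w_sub[OF order_refl that(3)]]]
    by simp
  have I': "AE t in lebesgue. t \<in> {a<..<b} \<longrightarrow> (I has_real_derivative w t) (at t)"
    unfolding I_def[abs_def] by (intro indefinite_integral_has_derivative_AE io w)
  \<comment> \<open>\<open>k\<close> is a Lipschitz constant of \<open>2 / sqrt c * sqrt x\<close> for \<open>x \<ge> p\<close>\<close>
  define k where "k = 1 / (sqrt c * sqrt p)"
  have k: "0 < k" using c pos by (simp add: k_def)
  define W where "W t = I t + 2 / sqrt c * sqrt (\<phi> t)" for t
  have "W b \<le> W a"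
  proof (rule ac_nonincreasing[OF ab])
    show "(\<lambda>x. \<bar>w x\<bar> + k * m x) absolutely_integrable_on {a..b}"
      using w_abs_sub[of a b] m by (intro set_integral_add set_integrable_mult_right) auto
  next
    fix s t assume st: "a \<le> s" "s \<le> t" "t \<le> b"
    have p: "p \<le> \<phi> s" "p \<le> \<phi> t" using pos st by auto
    then have "2 * sqrt p \<le> sqrt (\<phi> s) + sqrt (\<phi> t)"
      using real_sqrt_le_mono[of p "\<phi> s"] real_sqrt_le_mono[of p "\<phi> t"] by linarith
    moreover have "\<bar>sqrt (\<phi> t) - sqrt (\<phi> s)\<bar> * (sqrt (\<phi> s) + sqrt (\<phi> t)) = \<bar>\<phi> t - \<phi> s\<bar>"
    proof -
      have "\<bar>sqrt (\<phi> t) - sqrt (\<phi> s)\<bar> * (sqrt (\<phi> s) + sqrt (\<phi> t))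
          = \<bar>(sqrt (\<phi> t) - sqrt (\<phi> s)) * (sqrt (\<phi> s) + sqrt (\<phi> t))\<bar>"
        using p pos by (simp add: abs_mult)
      also have "(sqrt (\<phi> t) - sqrt (\<phi> s)) * (sqrt (\<phi> s) + sqrt (\<phi> t)) = \<phi> t - \<phi> s"
        using p pos by (simp add: algebra_simps)
      finally show ?thesis .
    qed
    ultimately have "\<bar>sqrt (\<phi> t) - sqrt (\<phi> s)\<bar> * (2 * sqrt p) \<le> \<bar>\<phi> t - \<phi> s\<bar>"
      by (metis abs_ge_zero mult_left_mono)
    then have "2 / sqrt c * \<bar>sqrt (\<phi> t) - sqrt (\<phi> s)\<bar> \<le> k * \<bar>\<phi> t - \<phi> s\<bar>"
      using c pos by (simp add: k_def field_simps)
    also have "\<dots> \<le> k * integral {s..t} m" using ac[OF st] k by simp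
    finally have 1: "\<bar>2 / sqrt c * sqrt (\<phi> t) - 2 / sqrt c * sqrt (\<phi> s)\<bar> \<le> k * integral {s..t} m"
      unfolding right_diff_distrib[symmetric] abs_mult using c by simp
    have 2: "\<bar>I t - I s\<bar> \<le> integral {s..t} (\<lambda>x. \<bar>w x\<bar>)"
      using integral_norm_bound_integral[of w "{s..t}" "\<lambda>x. \<bar>w x\<bar>"] I_diff[OF st]
        io[OF w_sub[OF st(1,3)]] io[OF w_abs_sub[OF st(1,3)]] by simp
    have "integral {s..t} (\<lambda>x. \<bar>w x\<bar> + k * m x) = integral {s..t} (\<lambda>x. \<bar>w x\<bar>) + k * integral {s..t} m"
      using io[OF m_sub[OF st(1,3)]] io[OF w_abs_sub[OF st(1,3)]]
      by (subst integral_add) (auto intro: integrable_on_mult_right)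
    with 1 2 show "\<bar>W t - W s\<bar> \<le> integral {s..t} (\<lambda>x. \<bar>w x\<bar> + k * m x)"
      unfolding W_def by linarith
  next
    show "AE t in lebesgue. t \<in> {a<..<b} \<longrightarrow> (\<exists>D\<le>0. (W has_real_derivative D) (at t))"
      using deriv I'
    proof eventually_elim
      case (elim t)
      show ?case
      proof (intro impI exI conjI)
        assume t: "t \<in> {a<..<b}"
        have \<phi>: "0 < \<phi> t" using pos(1) pos(2)[of t] t by auto
        have "((\<lambda>t. sqrt (\<phi> t)) has_real_derivative inverse (sqrt (\<phi> t)) / 2 * - (w t)\<^sup>2) (at t)"
          using elim t by (intro DERIV_chain2[where f = sqrt and g = \<phi>, OF DERIV_real_sqrt[OF \<phi>]]) auto
        then show "(W has_real_derivative w t + 2 / sqrt c * (inverse (sqrt (\<phi> t)) / 2 * - (w t)\<^sup>2)) (at t)"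
          unfolding W_def[abs_def] using elim t by (intro DERIV_add DERIV_cmult) auto
        \<comment> \<open>the derivative equals \<open>w (1 - w / sqrt (c \<phi>))\<close>\<close>
        have "sqrt c * sqrt (\<phi> t) \<le> w t"
          unfolding real_sqrt_mult[symmetric] using elim t by (intro real_le_lsqrt) auto
        then have "w t * (sqrt c * sqrt (\<phi> t)) \<le> w t * w t"
          using elim t by (intro mult_left_mono) auto
        then show "w t + 2 / sqrt c * (inverse (sqrt (\<phi> t)) / 2 * - (w t)\<^sup>2) \<le> 0"
          using \<phi> c by (simp add: field_simps power2_eq_square)
      qed
    qed
  qed
  then have "I b + 2 / sqrt c * sqrt (\<phi> b) \<le> 2 / sqrt c * sqrt (\<phi> a)"
    by (simp add: W_def I_def)
  then show "integral {a..b} w \<le> 2 / sqrt c * (sqrt (\<phi> a) - sqrt (\<phi> b))"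
    by (simp add: I_def algebra_simps)

  define Z where "Z t = ln (\<phi> t) + c * t" for t
  have "Z b \<le> Z a"
  proof (rule ac_nonincreasing[OF ab])
    show "(\<lambda>x. m x / p + c) absolutely_integrable_on {a..b}"
      using m by (intro set_integral_add set_integrable_divide) auto
  next
    fix s t assume st: "a \<le> s" "s \<le> t" "t \<le> b"
    have p: "p \<le> \<phi> s" "p \<le> \<phi> t" using pos st by auto
    have ln_le: "ln x - ln y \<le> \<bar>x - y\<bar> / p" if "p \<le> x" "p \<le> y" for x y
    proof -
      have "ln x - ln y \<le> (x - y) / y"
        using ln_diff_le[of x y] that pos by simp
      also have "\<dots> \<le> \<bar>x - y\<bar> / p"
        using that pos by (intro frac_le) auto
      finally show ?thesis .
    qed
    have "\<bar>ln (\<phi> t) - ln (\<phi> s)\<bar> \<le> \<bar>\<phi> t - \<phi> s\<bar> / p"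
      using ln_le[OF p] ln_le[OF p(2,1)] by (simp add: abs_minus_commute)
    also have "\<dots> \<le> integral {s..t} m / p"
      using ac[OF st] pos by (intro divide_right_mono) auto
    finally have "\<bar>Z t - Z s\<bar> \<le> integral {s..t} m / p + c * (t - s)"
      using c st mult_left_mono[of s t c] unfolding Z_def right_diff_distrib by linarith
    also have "\<dots> = integral {s..t} (\<lambda>x. m x / p + c)"
      using io[OF m_sub[OF st(1,3)]] st
      by (subst integral_add) (auto intro: integrable_on_divide simp: mult.commute)
    finally show "\<bar>Z t - Z s\<bar> \<le> integral {s..t} (\<lambda>x. m x / p + c)" .
  next
    show "AE t in lebesgue. t \<in> {a<..<b} \<longrightarrow> (\<exists>D\<le>0. (Z has_real_derivative D) (at t))"
      using deriv
    proof eventually_elim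
      case (elim t)
      show ?case
      proof (intro impI exI conjI)
        assume t: "t \<in> {a<..<b}"
        have \<phi>: "0 < \<phi> t" using pos(1) pos(2)[of t] t by auto
        show "(Z has_real_derivative - (w t)\<^sup>2 / \<phi> t + c) (at t)"
          unfolding Z_def[abs_def]
          using elim t \<phi> by (auto intro!: derivative_eq_intros simp: divide_inverse)
        show "- (w t)\<^sup>2 / \<phi> t + c \<le> 0"
          using elim t \<phi> by (simp add: field_simps)
      qed
    qed
  qed
  then have "ln (\<phi> b) \<le> ln (\<phi> a) - c * (b - a)"
    by (simp add: Z_def algebra_simps)
  then have "exp (ln (\<phi> b)) \<le> exp (- (c * (b - a)) + ln (\<phi> a))" by simp
  moreover have "0 < \<phi> a" "0 < \<phi> b" using pos(1) pos(2)[of a] pos(2)[of b] ab by auto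
  ultimately show "\<phi> b \<le> exp (- (c * (b - a))) * \<phi> a"
    by (simp only: exp_add exp_ln)
qed

text \<open>The lower bound on \<open>w\<close> is only assumed while \<open>y\<close> is in the ball and \<open>\<phi>\<close> is positive.
  At a first exit time with \<open>\<phi> > 0\<close> the length estimate is strictly below \<open>r\<close>, a contradiction.
  After the first zero of \<open>\<phi>\<close> the curve is constant. At that zero the length estimate only gives
  \<open>d(y\<^sub>0, y\<^sub>t) \<le> r\<close>, and in a general metric space the closure of the open ball may be smaller than the
  closed ball; membership in the closure is obtained as a limit from earlier times.\<close>

lemma confinement:
  fixes y :: "real \<Rightarrow> 'a::metric_space" and \<phi> w m :: "real \<Rightarrow> real"
  assumes c: "0 < c" and r: "0 < r" "2 / sqrt c * sqrt (\<phi> 0) \<le> r"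
    and m: "m absolutely_integrable_on {0..b}"
    and ac: "\<And>s t. \<lbrakk>0 \<le> s; s \<le> t; t \<le> b\<rbrakk> \<Longrightarrow> \<bar>\<phi> t - \<phi> s\<bar> \<le> integral {s..t} m"
    and w: "w absolutely_integrable_on {0..b}"
    and y: "\<And>s t. \<lbrakk>0 \<le> s; s \<le> t; t \<le> b\<rbrakk> \<Longrightarrow> dist (y t) (y s) \<le> integral {s..t} w"
    and nonneg: "\<And>t. t \<in> {0..b} \<Longrightarrow> 0 \<le> \<phi> t"
    and deriv: "AE t in lebesgue. t \<in> {0<..<b} \<longrightarrow>
        (\<phi> has_real_derivative - (w t)\<^sup>2) (at t) \<and> 0 \<le> w t \<and>
        (y t \<in> ball (y 0) r \<and> 0 < \<phi> t \<and> \<phi> t \<le> \<phi> 0 \<longrightarrow> c * \<phi> t \<le> (w t)\<^sup>2)"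
    and s: "0 \<le> s" "s \<le> b"
  shows "dist (y b) (y s) \<le> 2 / sqrt c * (sqrt (\<phi> s) - sqrt (\<phi> b))"
    and "\<phi> b \<le> exp (- (c * b)) * \<phi> 0"
    and "y b \<in> closure (ball (y 0) r)"
proof -
  note io = set_lebesgue_integral_eq_integral(1)
  have b: "0 \<le> b" using s by simp
  have m_sub: "m absolutely_integrable_on {u..v}" and w_sub: "w absolutely_integrable_on {u..v}"
    if "0 \<le> u" "v \<le> b" for u v
    using that by (auto intro: absolutely_integrable_on_subinterval[OF m]
        absolutely_integrable_on_subinterval[OF w])
  have AE_sub: "AE t in lebesgue. t \<in> {u<..<v} \<longrightarrow>
        (\<phi> has_real_derivative - (w t)\<^sup>2) (at t) \<and> 0 \<le> w t \<and>
        (y t \<in> ball (y 0) r \<and> 0 < \<phi> t \<and> \<phi> t \<le> \<phi> 0 \<longrightarrow> c * \<phi> t \<le> (w t)\<^sup>2)"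
    if "0 \<le> u" "v \<le> b" for u v
    using deriv by eventually_elim (use that in auto)
  have mono: "\<phi> v \<le> \<phi> u" if uv: "0 \<le> u" "u \<le> v" "v \<le> b" for u v
  proof (rule ac_nonincreasing[OF uv(2) m_sub[OF uv(1,3)]])
    show "\<bar>\<phi> t - \<phi> s\<bar> \<le> integral {s..t} m" if "u \<le> s" "s \<le> t" "t \<le> v" for s t
      using ac that uv by auto
    show "AE t in lebesgue. t \<in> {u<..<v} \<longrightarrow> (\<exists>D\<le>0. (\<phi> has_real_derivative D) (at t))"
      using AE_sub[OF uv(1,3)]
      by eventually_elim (metis neg_le_0_iff_le zero_le_power2)
  qed
  have \<phi>_cont: "continuous_on {0..b} \<phi>"
    using ac by (intro ac_continuous_on[OF io[OF m]]) (auto simp: dist_real_def)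
  have y_cont: "continuous_on {0..b} y"
    by (rule ac_continuous_on[OF io[OF w] y])
  have inside: "dist (y v) (y u) \<le> 2 / sqrt c * (sqrt (\<phi> u) - sqrt (\<phi> v))"
      "\<phi> v \<le> exp (- (c * (v - u))) * \<phi> u"
    if uv: "0 \<le> u" "u \<le> v" "v \<le> b" and "0 < \<phi> v"
      and ball: "\<And>t. u < t \<Longrightarrow> t < v \<Longrightarrow> y t \<in> ball (y 0) r" for u v
  proof -
    have ac': "\<bar>\<phi> t - \<phi> s\<bar> \<le> integral {s..t} m" if "u \<le> s" "s \<le> t" "t \<le> v" for s t
      using ac that uv by auto
    have pos': "\<phi> v \<le> \<phi> t" if "t \<in> {u..v}" for t
      using mono[of t v] that uv by auto
    have "AE t in lebesgue. t \<in> {u<..<v} \<longrightarrow>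
        (\<phi> has_real_derivative - (w t)\<^sup>2) (at t) \<and> 0 \<le> w t \<and> c * \<phi> t \<le> (w t)\<^sup>2"
      using AE_sub[OF uv(1,3)]
    proof eventually_elim
      case (elim t)
      show ?case
      proof
        assume t: "t \<in> {u<..<v}"
        then have "0 < \<phi> t" "\<phi> t \<le> \<phi> 0" "y t \<in> ball (y 0) r"
          using mono[of 0 t] pos'[of t] \<open>0 < \<phi> v\<close> uv ball by auto
        with elim t show "(\<phi> has_real_derivative - (w t)\<^sup>2) (at t) \<and> 0 \<le> w t \<and> c * \<phi> t \<le> (w t)\<^sup>2"
          by blast
      qed
    qed
    note * = decay_estimates[OF uv(2) c m_sub[OF uv(1,3)] ac' w_sub[OF uv(1,3)] \<open>0 < \<phi> v\<close> pos' this]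
    show "dist (y v) (y u) \<le> 2 / sqrt c * (sqrt (\<phi> u) - sqrt (\<phi> v))"
      using y[OF uv] *(1) by simp
    show "\<phi> v \<le> exp (- (c * (v - u))) * \<phi> u" by (rule *(2))
  qed
  have stays: "y t \<in> ball (y 0) r" if t: "0 \<le> t" "t \<le> b" "0 < \<phi> t" for t
  proof (rule ccontr)
    assume "y t \<notin> ball (y 0) r"
    \<comment> \<open>the minimum of \<open>E\<close> is the first exit time\<close>
    define E where "E = {u \<in> {0..t}. r \<le> dist (y 0) (y u)}"
    have "continuous_on {0..t} (\<lambda>u. dist (y 0) (y u))"
      using t by (intro continuous_intros continuous_on_subset[OF y_cont]) auto
    moreover have "E = {0..t} \<inter> (\<lambda>u. dist (y 0) (y u)) -` {r..}"
      by (auto simp: E_def)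
    ultimately have "closed E"
      by (simp add: continuous_closed_preimage)
    moreover have "E \<subseteq> {0..t}" by (auto simp: E_def)
    ultimately have "compact E"
      unfolding compact_eq_bounded_closed
      by (blast intro: bounded_subset[OF bounded_closed_interval])
    moreover have "E \<noteq> {}"
      using \<open>y t \<notin> ball (y 0) r\<close> t by (auto simp: E_def not_less)
    ultimately have "\<exists>t1\<in>E. \<forall>u\<in>E. t1 \<le> u" by (rule compact_attains_inf)
    then obtain t1 where t1: "t1 \<in> E" "\<And>u. u \<in> E \<Longrightarrow> t1 \<le> u" by auto
    have t1': "0 \<le> t1" "t1 \<le> t" "r \<le> dist (y 0) (y t1)" using t1(1) by (auto simp: E_def)
    have "0 < \<phi> t1" using mono[of t1 t] t1' t by auto
    have "dist (y t1) (y 0) \<le> 2 / sqrt c * (sqrt (\<phi> 0) - sqrt (\<phi> t1))"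
    proof (rule inside(1))
      show "y u \<in> ball (y 0) r" if "0 < u" "u < t1" for u
        using t1(2)[of u] t1' that by (cases "r \<le> dist (y 0) (y u)") (auto simp: E_def)
    qed (use t1' t \<open>0 < \<phi> t1\<close> in auto)
    also have "\<dots> < 2 / sqrt c * sqrt (\<phi> 0)"
      using c \<open>0 < \<phi> t1\<close> by (intro mult_strict_left_mono) auto
    also have "\<dots> \<le> r" by (rule r)
    finally show False using t1' by (simp add: dist_commute)
  qed
  have main: "dist (y b) (y s) \<le> 2 / sqrt c * (sqrt (\<phi> s) - sqrt (\<phi> b)) \<and>
      \<phi> b \<le> exp (- (c * b)) * \<phi> 0 \<and> y b \<in> closure (ball (y 0) r)"
  proof (cases "0 < \<phi> b")
    case True
    have in_ball: "y t \<in> ball (y 0) r" if "0 \<le> t" "t \<le> b" for t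
      using that True mono[of t b] by (intro stays) auto
    show ?thesis
      using inside[of s b] inside[of 0 b] in_ball True s b closure_subset[of "ball (y 0) r"] by auto
  next
    case False
    then have \<phi>b: "\<phi> b = 0" using nonneg[of b] b by simp
    \<comment> \<open>the minimum of \<open>Z\<close> is the first zero of \<open>\<phi>\<close>\<close>
    define Z where "Z = {u \<in> {0..b}. \<phi> u = 0}"
    have "closed Z"
      unfolding Z_def by (intro continuous_closed_preimage_constant \<phi>_cont) auto
    then have "compact Z"
      unfolding compact_eq_bounded_closed
      by (auto simp: Z_def intro: bounded_subset[OF bounded_closed_interval[of 0 b]])
    moreover have "Z \<noteq> {}" using b \<phi>b by (auto simp: Z_def)
    ultimately have "\<exists>t1\<in>Z. \<forall>u\<in>Z. t1 \<le> u" by (rule compact_attains_inf)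
    then obtain t1 where t1: "t1 \<in> Z" "\<And>u. u \<in> Z \<Longrightarrow> t1 \<le> u" by auto
    have t1': "0 \<le> t1" "t1 \<le> b" "\<phi> t1 = 0" using t1(1) by (auto simp: Z_def)
    have zero: "\<phi> t = 0" if "t1 \<le> t" "t \<le> b" for t
      using mono[of t1 t] nonneg[of t] that t1' by auto
    have pos: "0 < \<phi> t" if "0 \<le> t" "t < t1" for t
      using t1(2)[of t] nonneg[of t] that t1' by (force simp: Z_def)
    have const: "y b = y t" if t: "t1 \<le> t" "t \<le> b" for t
    proof -
      have "AE x in lebesgue. x \<in> {t<..<b} \<longrightarrow> w x \<le> 0"
        using AE_sub[OF order_trans[OF t1'(1) t(1)] order_refl]
      proof eventually_elim
        case (elim x)
        show ?case
        proof
          assume x: "x \<in> {t<..<b}"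
          have "((\<lambda>_. 0) has_real_derivative 0) (at x)" by simp
          then have "(\<phi> has_real_derivative 0) (at x)"
          proof (rule has_field_derivative_transform_within_open)
            show "0 = \<phi> u" if "u \<in> {t<..<b}" for u using zero[of u] that t by auto
          qed (use x in auto)
          with elim x have "- (w x)\<^sup>2 = 0" by (blast intro: DERIV_unique)
          then show "w x \<le> 0" by simp
        qed
      qed
      then have "integral {t..b} w \<le> integral {t..b} (\<lambda>_. 0)"
        using t t1' by (intro integral_le_AE io w_sub) auto
      then have "dist (y b) (y t) \<le> 0"
        using y[of t b] t t1' by (simp del: dist_le_zero_iff)
      then show ?thesis by simp
    qed
    have yb: "y b = y t1" using const[of t1] t1' by simp
    have lim_y: "(y \<longlongrightarrow> y t1) (at_left t1)" and lim_\<phi>: "(\<phi> \<longlongrightarrow> \<phi> t1) (at_left t1)" if "0 < t1"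
      using continuous_on_Icc_at_leftD[OF continuous_on_subset[OF y_cont, of "{0..t1}"] that]
        continuous_on_Icc_at_leftD[OF continuous_on_subset[OF \<phi>_cont, of "{0..t1}"] that] t1'(2)
      by simp_all
    have near: "eventually (\<lambda>u. u \<in> {z<..<t1}) (at_left t1)" if "z < t1" for z
      using eventually_at_left_real[OF that] by simp
    have "dist (y b) (y s) \<le> 2 / sqrt c * (sqrt (\<phi> s) - sqrt (\<phi> b))"
    proof (cases "t1 \<le> s")
      case True
      then show ?thesis using const[of s] zero[of s] s \<phi>b by simp
    next
      case False
      then have "s < t1" by simp
      have "dist (y t1) (y s) \<le> 2 / sqrt c * (sqrt (\<phi> s) - sqrt (\<phi> t1))"
      proof (rule tendsto_le)
        show "((\<lambda>u. dist (y u) (y s)) \<longlongrightarrow> dist (y t1) (y s)) (at_left t1)"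
          using False s by (intro tendsto_intros lim_y) auto
        show "((\<lambda>u. 2 / sqrt c * (sqrt (\<phi> s) - sqrt (\<phi> u)))
            \<longlongrightarrow> 2 / sqrt c * (sqrt (\<phi> s) - sqrt (\<phi> t1))) (at_left t1)"
          using False s by (intro tendsto_intros lim_\<phi>) auto
        show "eventually (\<lambda>u. dist (y u) (y s) \<le> 2 / sqrt c * (sqrt (\<phi> s) - sqrt (\<phi> u))) (at_left t1)"
          using near[OF \<open>s < t1\<close>]
        proof eventually_elim
          case (elim u)
          then show ?case
            using s t1' pos by (intro inside(1) stays) auto
        qed
      qed simp
      then show ?thesis by (simp add: yb \<phi>b t1')
    qed
    moreover have "\<phi> b \<le> exp (- (c * b)) * \<phi> 0" using \<phi>b nonneg[of 0] b by simp
    moreover have "y b \<in> closure (ball (y 0) r)"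
    proof (cases "t1 = 0")
      case True
      then show ?thesis using yb r closure_subset[of "ball (y 0) r"] by auto
    next
      case False
      then have t1_pos: "0 < t1" using t1' by simp
      have "eventually (\<lambda>u. y u \<in> closure (ball (y 0) r)) (at_left t1)"
        using near[OF t1_pos]
      proof eventually_elim
        case (elim u)
        then have "y u \<in> ball (y 0) r" using t1' pos by (intro stays) auto
        then show ?case using closure_subset by blast
      qed
      then have "y t1 \<in> closure (ball (y 0) r)"
        by (intro Lim_in_closed_set[OF closed_closure _ _ lim_y[OF t1_pos]]) auto
      then show ?thesis by (simp add: yb)
    qed
    ultimately show ?thesis by blast
  qed
  then show "dist (y b) (y s) \<le> 2 / sqrt c * (sqrt (\<phi> s) - sqrt (\<phi> b))"
    "\<phi> b \<le> exp (- (c * b)) * \<phi> 0" "y b \<in> closure (ball (y 0) r)"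
    by auto
qed

section \<open>Curves of maximal slope on half-open intervals\<close>

text \<open>On compact subintervals, absolute continuity identifies the value of \<open>metric_speed\<close> with the
  limit of the difference quotients, and the value of \<open>deriv\<close> with the derivative of \<open>\<phi>\<close>, at almost every time.
  Hence the energy identity holds almost everywhere.\<close>

lemma curve_of_maximal_slope_on_Icc:
  fixes f :: "'a::metric_space \<Rightarrow> ereal" and y :: "real \<Rightarrow> 'a" and T :: ereal
  defines "J \<equiv> {t. 0 \<le> t \<and> ereal t < T}"
  defines "\<phi> \<equiv> \<lambda>s. real_of_ereal (f (y s))"
  assumes cms: "curve_of_maximal_slope f J y" and b: "0 \<le> b" "ereal b < T"
  obtains m where "m absolutely_integrable_on {0..b}"
    "\<forall>s t. 0 \<le> s \<and> s \<le> t \<and> t \<le> b \<longrightarrow> \<bar>\<phi> t - \<phi> s\<bar> \<le> integral {s..t} m"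
    "metric_speed J y absolutely_integrable_on {0..b}"
    "\<forall>s t. 0 \<le> s \<and> s \<le> t \<and> t \<le> b \<longrightarrow> dist (y t) (y s) \<le> integral {s..t} (metric_speed J y)"
    "AE t in lebesgue. t \<in> {0<..<b} \<longrightarrow> 0 \<le> metric_speed J y t \<and>
       slope f (y t) = ereal (metric_speed J y t) \<and>
       (\<phi> has_real_derivative - (metric_speed J y t)\<^sup>2) (at t)"
proof -
  note io = set_lebesgue_integral_eq_integral(1)
  have J: "{0..b} \<subseteq> J"
  proof
    fix t assume "t \<in> {0..b}"
    then have "ereal t \<le> ereal b" by simp
    with b(2) have "ereal t < T" by (rule le_less_trans[rotated])
    with \<open>t \<in> {0..b}\<close> show "t \<in> J" by (simp add: J_def)
  qed
  then have J_int: "at t within J = at t" if "t \<in> {0<..<b}" for t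
    by (intro at_within_open_subset[of _ "{0<..<b}"] that) auto
  have fin: "\<bar>f (y t)\<bar> \<noteq> \<infinity>" if "t \<in> J" for t
    using cms that by (simp add: curve_of_maximal_slope_def)
  from cms have "AC1_loc J y" "AC1_loc J \<phi>"
    by (simp_all add: curve_of_maximal_slope_def \<phi>_def)
  then obtain my m\<phi> where my_abs: "my absolutely_integrable_on {0..b}"
      and my': "\<And>s t. s \<in> J \<Longrightarrow> t \<in> J \<Longrightarrow> s < t \<Longrightarrow> dist (y t) (y s) \<le> integral {s..t} my"
      and m\<phi>_abs: "m\<phi> absolutely_integrable_on {0..b}"
      and m\<phi>': "\<And>s t. s \<in> J \<Longrightarrow> t \<in> J \<Longrightarrow> s < t \<Longrightarrow> dist (\<phi> t) (\<phi> s) \<le> integral {s..t} m\<phi>"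
    unfolding AC1_loc_def using J compact_Icc[of 0 b] by metis
  have my: "dist (y t) (y s) \<le> integral {s..t} my"
    and m\<phi>: "\<bar>\<phi> t - \<phi> s\<bar> \<le> integral {s..t} m\<phi>" if "0 \<le> s" "s \<le> t" "t \<le> b" for s t
  proof -
    have "s \<in> J" "t \<in> J" using that J by auto
    with my'[of s t] m\<phi>'[of s t] that
    show "dist (y t) (y s) \<le> integral {s..t} my" "\<bar>\<phi> t - \<phi> s\<bar> \<le> integral {s..t} m\<phi>"
      by (cases "s = t"; simp add: dist_real_def)+
  qed
  obtain v where v: "v absolutely_integrable_on {0..b}"
    "\<And>s t. \<lbrakk>0 \<le> s; s \<le> t; t \<le> b\<rbrakk> \<Longrightarrow> dist (y t) (y s) \<le> integral {s..t} v"
    "AE t in lebesgue. t \<in> {0<..<b} \<longrightarrow> ((\<lambda>s. dist (y s) (y t) / \<bar>s - t\<bar>) \<longlongrightarrow> v t) (at t)"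
    using ac_metric_speed[OF b(1) my_abs my] by blast
  let ?w = "metric_speed J y"
  have w_eq: "AE t in lebesgue. t \<in> {0<..<b} \<longrightarrow> ?w t = v t"
    using v(3)
  proof eventually_elim
    case (elim t)
    show ?case
    proof
      assume t: "t \<in> {0<..<b}"
      with elim show "?w t = v t"
        unfolding metric_speed_def J_int[OF t] by (intro tendsto_Lim) auto
    qed
  qed
  then obtain N where N: "N \<in> null_sets lebesgue"
    "{t \<in> space lebesgue. \<not> (t \<in> {0<..<b} \<longrightarrow> ?w t = v t)} \<subseteq> N"
    unfolding eventually_ae_filter by blast
  have w_abs: "?w absolutely_integrable_on {0..b}"
  proof (rule absolutely_integrable_spike[OF v(1)])
    show "negligible (N \<union> {0, b})"
      using N(1) by (auto simp: negligible_iff_null_sets[symmetric] intro: negligible_Un)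
    show "?w t = v t" if "t \<in> {0..b} - (N \<union> {0, b})" for t
    proof (rule ccontr)
      assume "?w t \<noteq> v t"
      with that have "t \<in> {t \<in> space lebesgue. \<not> (t \<in> {0<..<b} \<longrightarrow> ?w t = v t)}" by auto
      with N(2) have "t \<in> N" by (rule subsetD)
      with that show False by simp
    qed
  qed
  have w_dist: "dist (y t) (y s) \<le> integral {s..t} ?w" if st: "0 \<le> s" "s \<le> t" "t \<le> b" for s t
  proof -
    have "AE x in lebesgue. x \<in> {s<..<t} \<longrightarrow> v x \<le> ?w x"
      using w_eq by eventually_elim (use st in auto)
    then have "integral {s..t} v \<le> integral {s..t} ?w"
      using st by (intro integral_le_AE io absolutely_integrable_on_subinterval[OF v(1)]
          absolutely_integrable_on_subinterval[OF w_abs]) auto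
    with v(2)[OF st] show ?thesis by simp
  qed
  obtain g where g: "AE t in lebesgue. t \<in> {0<..<b} \<longrightarrow> (\<phi> has_real_derivative g t) (at t)"
    by (rule ac_has_derivative_AE[OF b(1) m\<phi>_abs m\<phi>])
  have ineq: "AE t in lebesgue. t \<in> J \<longrightarrow> ereal (1/2) * ereal ((?w t)\<^sup>2) +
      ereal (1/2) * (slope f (y t))\<^sup>2 \<le> ereal (- deriv \<phi> t)"
    using cms by (simp add: curve_of_maximal_slope_def \<phi>_def)
  have "AE t in lebesgue. t \<in> {0<..<b} \<longrightarrow> 0 \<le> ?w t \<and> slope f (y t) = ereal (?w t) \<and>
       (\<phi> has_real_derivative - (?w t)\<^sup>2) (at t)"
    using v(3) w_eq g ineq
  proof eventually_elim
    case (elim t)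
    show ?case
    proof
      assume t: "t \<in> {0<..<b}"
      then have tJ: "t \<in> J" using J by auto
      have lim: "((\<lambda>s. dist (y s) (y t) / \<bar>s - t\<bar>) \<longlongrightarrow> ?w t) (at t)" using elim t by simp
      have D: "(\<phi> has_real_derivative g t) (at t)" using elim t by simp
      have "eventually (\<lambda>s. s \<in> {0<..<b}) (at t)"
        using t by (intro eventually_at_in_open') auto
      then have ev: "eventually (\<lambda>s. \<bar>f (y s)\<bar> \<noteq> \<infinity>) (at t)"
      proof eventually_elim
        case (elim s)
        then have "s \<in> J" using J by auto
        then show ?case by (rule fin)
      qed
      have le: "ereal (1/2) * ereal ((?w t)\<^sup>2) + ereal (1/2) * (slope f (y t))\<^sup>2 \<le> ereal (- g t)"
        using elim tJ DERIV_imp_deriv[OF D] by simp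
      note e = energy_identity[OF ev fin[OF tJ] D[unfolded \<phi>_def] lim le]
      have "0 \<le> ?w t" by (rule tendsto_lowerbound[OF lim]) auto
      then show "0 \<le> ?w t \<and> slope f (y t) = ereal (?w t) \<and>
          (\<phi> has_real_derivative - (?w t)\<^sup>2) (at t)"
        using e D by simp
    qed
  qed
  with m\<phi>_abs m\<phi> w_abs w_dist show ?thesis by (intro that[of m\<phi>]) auto
qed

lemma starts_at_0_eq:
  fixes y :: "real \<Rightarrow> 'a::metric_space"
  assumes "starts_at {t. 0 \<le> t \<and> ereal t < T} y x" and b: "0 < b" "ereal b < T"
    and cont: "continuous_on {0..b} y"
  shows "y 0 = x"
proof -
  let ?J = "{t. 0 \<le> t \<and> ereal t < T}"
  have "ereal 0 < ereal b" using b by simp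
  then have "ereal 0 < T" using b(2) by (rule less_trans)
  then have "(INF t\<in>?J. ereal t) = ereal 0"
    by (intro antisym INF_lower2[of 0] INF_greatest) auto
  then have "((\<lambda>t. y (real_of_ereal t)) \<longlongrightarrow> x) (filtermap ereal (at_right 0))"
    using assms(1) by (simp add: starts_at_def at_right_ereal)
  then have "(y \<longlongrightarrow> x) (at_right 0)"
    by (simp add: filterlim_filtermap)
  moreover have "(y \<longlongrightarrow> y 0) (at_right 0)"
    using continuous_on_Icc_at_rightD[OF cont b(1)] .
  ultimately show ?thesis
    by (intro tendsto_unique[of "at_right (0::real)"]) auto
qed

text \<open>The filter of left neighbourhoods of an extended real \<open>T > 0\<close> comes from a filter on the reals,
  which allows \<open>T < \<infinity>\<close> and \<open>T = \<infinity>\<close> to be treated together.\<close>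

lemma at_left_ereal_filter:
  fixes T :: ereal
  assumes "0 < T"
  obtains F :: "real filter" where "at_left T = filtermap ereal F" "F \<noteq> bot"
    "\<forall>b. ereal b < T \<longrightarrow> eventually (\<lambda>t. b < t \<and> ereal t < T) F"
    "\<forall>s. T = ereal s \<longrightarrow> F = at_left s"
proof (cases T)
  case (real s)
  show ?thesis
  proof (rule that[of "at_left s"])
    show "\<forall>b. ereal b < T \<longrightarrow> eventually (\<lambda>t. b < t \<and> ereal t < T) (at_left s)"
      using eventually_at_left_real[of _ s] real by (auto elim: eventually_mono)
  qed (use real in \<open>auto simp: at_left_ereal\<close>)
next
  case PInf
  show ?thesis
  proof (rule that[of at_top])
    show "\<forall>b. ereal b < T \<longrightarrow> eventually (\<lambda>t. b < t \<and> ereal t < T) at_top"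
      using PInf by (auto intro: eventually_gt_at_top)
  qed (use PInf in \<open>auto simp: at_left_PInf\<close>)
qed (use assms in auto)

lemma lower_semicont_le_limit:
  fixes f :: "'a::topological_space \<Rightarrow> ereal"
  assumes f: "lower_semicont f" and y: "(y \<longlongrightarrow> x) F" and "F \<noteq> bot"
    and le: "eventually (\<lambda>t. f (y t) \<le> B) F"
  shows "f x \<le> B"
proof (rule ccontr)
  assume "\<not> f x \<le> B"
  then have x: "B < f x" by simp
  also have "\<dots> \<le> Liminf (at x) f" using f by (simp add: lower_semicont_def)
  finally have "eventually (\<lambda>z. B < f z) (at x)" by (rule less_LiminfD)
  with x have "eventually (\<lambda>z. B < f z) (nhds x)" by (simp add: eventually_nhds_conv_at)
  from eventually_compose_filterlim[OF this y] le have "eventually (\<lambda>_. False) F"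
    by eventually_elim simp
  with \<open>F \<noteq> bot\<close> show False by simp
qed

text \<open>Distances are bounded by the decrease of a nonnegative function \<open>h\<close>. Since \<open>h\<close> is then nonincreasing
  and bounded below, this is a Cauchy criterion.\<close>

lemma tendsto_of_dist_le_diff:
  fixes y :: "real \<Rightarrow> 'a::complete_space" and h :: "real \<Rightarrow> real"
  assumes dist: "\<And>s t. \<lbrakk>0 \<le> s; s \<le> t; ereal t < T\<rbrakk> \<Longrightarrow> dist (y t) (y s) \<le> h s - h t"
    and h: "\<And>t. \<lbrakk>0 \<le> t; ereal t < T\<rbrakk> \<Longrightarrow> 0 \<le> h t"
    and T: "0 < T" and F: "F \<noteq> bot"
      "\<And>b. ereal b < T \<Longrightarrow> eventually (\<lambda>t. b < t \<and> ereal t < T) F"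
  shows "\<exists>yT. (y \<longlongrightarrow> yT) F"
proof -
  let ?J = "{t. 0 \<le> t \<and> ereal t < T}"
  define L where "L = Inf (h ` ?J)"
  have "?J \<noteq> {}" using T by (auto intro: exI[of _ 0] simp: zero_ereal_def[symmetric])
  have L: "L \<le> h t" if "t \<in> ?J" for t
    unfolding L_def using h that by (intro cInf_lower bdd_belowI2[of _ 0]) auto
  have "cauchy_filter (filtermap y F)"
    unfolding cauchy_filter_metric_filtermap
  proof (intro allI impI)
    fix e :: real assume "0 < e"
    then obtain b where b: "0 \<le> b" "ereal b < T" "h b < L + e"
      using cInf_lessD[of "h ` ?J" "L + e"] \<open>?J \<noteq> {}\<close> unfolding L_def by auto
    have small: "dist (y s) (y t) < e" if "b < s" "s \<le> t" "ereal t < T" for s t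
    proof -
      have "ereal s < T" using that by (meson ereal_less_eq(3) order_le_less_trans)
      then have "0 \<le> h b - h s"
        using dist[of b s] b that by (meson less_imp_le order_trans zero_le_dist)
      then show ?thesis
        using dist[of s t] L[of t] that b by (simp add: dist_commute)
    qed
    show "\<exists>P. eventually P F \<and> (\<forall>x z. P x \<and> P z \<longrightarrow> dist (y x) (y z) < e)"
    proof (intro exI conjI allI impI)
      show "eventually (\<lambda>t. b < t \<and> ereal t < T) F" using F(2) b(2) .
      show "dist (y x) (y z) < e"
        if "(b < x \<and> ereal x < T) \<and> b < z \<and> ereal z < T" for x z
        using small[of x z] small[of z x] that by (cases "x \<le> z") (auto simp: dist_commute)
    qed
  qed
  moreover have "filtermap y F \<noteq> bot" using F(1) by (simp add: filtermap_bot_iff)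
  ultimately obtain yT where "filtermap y F \<le> nhds yT"
    using cauchy_filter_complete_converges[of "filtermap y F" UNIV] complete_UNIV by auto
  then show ?thesis by (auto simp: filterlim_def)
qed

section \<open>Convergence of the curve\<close>

text \<open>If \<open>f x0 = 0\<close>, the infimum defining \<open>alpha\<close> ranges over the empty set and equals \<open>\<infinity>\<close>.\<close>

lemma alpha_pos:
  assumes f_nonneg: "\<And>x. 0 \<le> f x" and "0 < r"
    and dom: "x0 \<in> eff_dom f"
    and \<alpha>: "4 * f x0 / ereal (r\<^sup>2) \<le> alpha f x0 r"
  shows "0 < alpha f x0 r"
proof (cases "f x0 = 0")
  case True
  then have *: "{(slope f x)\<^sup>2 / f x | x. x \<in> ball x0 r \<and> 0 < f x \<and> f x \<le> f x0} = {}"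
    by auto
  show ?thesis unfolding alpha_def * by (simp add: top_ereal_def)
next
  case False
  obtain a where a: "f x0 = ereal a"
    using dom f_nonneg[of x0] by (cases "f x0") (auto simp: eff_dom_def)
  with False f_nonneg[of x0] have "0 < a" by (simp add: less_le)
  then have "0 < 4 * f x0 / ereal (r\<^sup>2)"
    using \<open>0 < r\<close> by (simp add: a)
  with \<alpha> show ?thesis by (rule less_le_trans[rotated])
qed

lemma exp_ereal_simps [simp]:
  "exp_ereal (ereal x) = ereal (exp x)" "exp_ereal (- \<infinity>) = 0" "exp_ereal 0 = 1"
  by (simp_all add: exp_ereal_def zero_ereal_def one_ereal_def)

lemma exp_ereal_nonneg: "0 \<le> exp_ereal x"
  by (cases x) (auto simp: exp_ereal_def)

text \<open>This is used for \<open>c\<close> tending to infinity when \<open>alpha\<close> is infinite, and once more with a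
  time variable in the role of \<open>c\<close> when \<open>T = \<infinity>\<close>.\<close>

lemma nonpos_if_exp_bounds:
  fixes g C s c0 :: real
  assumes "0 < s" and "\<And>c. c0 \<le> c \<Longrightarrow> g \<le> C * exp (- (c * s))"
  shows "g \<le> 0"
proof (rule tendsto_lowerbound)
  have "filterlim (\<lambda>c. - (c * s)) at_bot at_top"
    using \<open>0 < s\<close>
    by (simp add: filterlim_uminus_at_bot filterlim_at_top_mult_tendsto_pos[OF tendsto_const _ filterlim_ident])
  then have "((\<lambda>c. exp (- (c * s))) \<longlongrightarrow> 0) at_top"
    by (rule filterlim_compose[OF exp_at_bot])
  then show "((\<lambda>c. C * exp (- (c * s))) \<longlongrightarrow> 0) at_top"
    by (rule tendsto_mult_right_zero)
  show "eventually (\<lambda>c. g \<le> C * exp (- (c * s))) at_top"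
    using eventually_ge_at_top[of c0] by eventually_elim (rule assms(2))
qed simp

theorem corollary1p5:
  fixes f :: "'a::complete_space \<Rightarrow> ereal"
    and x0 :: 'a and r :: real and T :: ereal and y :: "real \<Rightarrow> 'a"
  assumes f_nonneg: "\<And>x. 0 \<le> f x"
    and "proper f"
    and "lower_semicont f"
    and "x0 \<in> eff_dom f"
    and "0 < r"
    and "alpha f x0 r \<ge> 4 * f x0 / ereal (r\<^sup>2)"
    and "0 < T"
    and "curve_of_maximal_slope f {t. 0 \<le> t \<and> ereal t < T} y"
    and "starts_at {t. 0 \<le> t \<and> ereal t < T} y x0"
  shows "\<exists>yT. ((\<lambda>t::ereal. y (real_of_ereal t)) \<longlongrightarrow> yT) (at_left T) \<and>
           (\<forall>t::ereal. 0 \<le> t \<and> t \<le> T \<longrightarrow>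
              extend_end T yT y t \<in> closure (ball x0 r) \<and>
              ereal (dist (extend_end T yT y t) yT) \<le> ereal r * exp_ereal (- (alpha f x0 r * t / 2)) \<and>
              f (extend_end T yT y t) \<le> exp_ereal (- (alpha f x0 r * t)) * f x0)"
proof -
  let ?J = "{t. 0 \<le> t \<and> ereal t < T}"
  let ?A = "alpha f x0 r"
  define \<phi> where "\<phi> = (\<lambda>s. real_of_ereal (f (y s)))"
  have f_y: "f (y t) = ereal (\<phi> t)" and \<phi>_nonneg: "0 \<le> \<phi> t" if "0 \<le> t" "ereal t < T" for t
  proof -
    have "\<bar>f (y t)\<bar> \<noteq> \<infinity>"
      using assms(8) that by (simp add: curve_of_maximal_slope_def)
    then show "f (y t) = ereal (\<phi> t)" by (simp add: \<phi>_def ereal_real)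
    show "0 \<le> \<phi> t" using f_nonneg[of "y t"] by (simp add: \<phi>_def real_of_ereal_pos)
  qed
  obtain F where F: "at_left T = filtermap ereal F" "F \<noteq> bot"
      and F_ev': "\<forall>b. ereal b < T \<longrightarrow> eventually (\<lambda>t. b < t \<and> ereal t < T) F"
      and F_real: "\<forall>s. T = ereal s \<longrightarrow> F = at_left s"
    by (rule at_left_ereal_filter[OF \<open>0 < T\<close>])
  have F_ev: "eventually (\<lambda>t. b < t \<and> ereal t < T) F" if "ereal b < T" for b
    using F_ev' that by blast
  obtain b0 where b0: "0 < b0" "ereal b0 < T"
    using ereal_dense2[OF \<open>0 < T\<close>] by (auto simp: zero_ereal_def)
  have y0: "y 0 = x0"
  proof -
    have "0 \<le> b0" using b0 by simp
    then obtain m where m: "metric_speed ?J y absolutely_integrable_on {0..b0}"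
      "\<forall>s t. 0 \<le> s \<and> s \<le> t \<and> t \<le> b0 \<longrightarrow> dist (y t) (y s) \<le> integral {s..t} (metric_speed ?J y)"
      by (rule curve_of_maximal_slope_on_Icc[OF assms(8) _ b0(2)])
    have "continuous_on {0..b0} y"
      by (rule ac_continuous_on[OF set_lebesgue_integral_eq_integral(1)[OF m(1)]]) (use m(2) in blast)
    with assms(9) b0 show ?thesis by (rule starts_at_0_eq)
  qed
  have f_x0: "f x0 = ereal (\<phi> 0)" and \<phi>0: "0 \<le> \<phi> 0"
    using f_y[of 0] \<phi>_nonneg[of 0] \<open>0 < T\<close> by (auto simp: y0 zero_ereal_def)
  have A_pos: "0 < ?A"
    using assms by (intro alpha_pos)
  \<comment> \<open>The estimates hold for every real rate \<open>c\<close> in this range. It contains \<open>alpha\<close> if that is finite,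
    and all large numbers otherwise.\<close>
  define admissible where
    "admissible c \<longleftrightarrow> 0 < c \<and> ereal c \<le> ?A \<and> 4 * \<phi> 0 / r\<^sup>2 \<le> c" for c
  have A_adm: "admissible a" if "?A = ereal a" for a
    using assms(6) A_pos \<open>0 < r\<close> that by (simp add: admissible_def f_x0)
  have inf_adm: "admissible c" if "?A = \<infinity>" "max 1 (4 * \<phi> 0 / r\<^sup>2) \<le> c" for c
    using that by (simp add: admissible_def)
  have sqrt_r: "2 / sqrt c * sqrt (\<phi> 0) \<le> r" if "admissible c" for c
  proof -
    have "4 * \<phi> 0 / r\<^sup>2 \<le> c" "0 < c" using that by (auto simp: admissible_def)
    then have "4 * \<phi> 0 / c \<le> r\<^sup>2" using \<open>0 < r\<close> by (simp add: field_simps)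
    then have "sqrt (4 * \<phi> 0 / c) \<le> r" using \<open>0 < r\<close> by (intro real_le_lsqrt) auto
    then show ?thesis by (simp add: real_sqrt_divide real_sqrt_mult)
  qed
  have est: "dist (y t) (y s) \<le> 2 / sqrt c * (sqrt (\<phi> s) - sqrt (\<phi> t))"
      "\<phi> t \<le> exp (- (c * t)) * \<phi> 0" "y t \<in> closure (ball x0 r)"
    if c: "admissible c" and st: "0 \<le> s" "s \<le> t" "ereal t < T" for c s t
  proof -
    have t: "0 \<le> t" using st by simp
    obtain m where m: "m absolutely_integrable_on {0..t}"
      "\<forall>u v. 0 \<le> u \<and> u \<le> v \<and> v \<le> t \<longrightarrow> \<bar>\<phi> v - \<phi> u\<bar> \<le> integral {u..v} m"
      "metric_speed ?J y absolutely_integrable_on {0..t}"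
      "\<forall>u v. 0 \<le> u \<and> u \<le> v \<and> v \<le> t \<longrightarrow> dist (y v) (y u) \<le> integral {u..v} (metric_speed ?J y)"
      "AE u in lebesgue. u \<in> {0<..<t} \<longrightarrow> 0 \<le> metric_speed ?J y u \<and>
         slope f (y u) = ereal (metric_speed ?J y u) \<and>
         (\<phi> has_real_derivative - (metric_speed ?J y u)\<^sup>2) (at u)"
      unfolding \<phi>_def by (rule curve_of_maximal_slope_on_Icc[OF assms(8) t st(3)])
    have m2: "\<bar>\<phi> v - \<phi> u\<bar> \<le> integral {u..v} m"
      and m4: "dist (y v) (y u) \<le> integral {u..v} (metric_speed ?J y)"
      if "0 \<le> u" "u \<le> v" "v \<le> t" for u v
      using m(2,4) that by blast+
    have less_T: "ereal u < T" if "u \<le> t" for u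
      using that st(3) by (meson ereal_less_eq(3) order_le_less_trans)
    have nonneg: "0 \<le> \<phi> u" if "u \<in> {0..t}" for u
      using \<phi>_nonneg[of u] less_T[of u] that by simp
    have c_pos: "0 < c" using c by (simp add: admissible_def)
    have "AE u in lebesgue. u \<in> {0<..<t} \<longrightarrow>
        (\<phi> has_real_derivative - (metric_speed ?J y u)\<^sup>2) (at u) \<and> 0 \<le> metric_speed ?J y u \<and>
        (y u \<in> ball (y 0) r \<and> 0 < \<phi> u \<and> \<phi> u \<le> \<phi> 0 \<longrightarrow> c * \<phi> u \<le> (metric_speed ?J y u)\<^sup>2)"
      using m(5)
    proof eventually_elim
      case (elim u)
      show ?case
      proof (intro impI conjI; (elim conjE)?)
        assume u: "u \<in> {0<..<t}"
        then show "(\<phi> has_real_derivative - (metric_speed ?J y u)\<^sup>2) (at u)"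
          "0 \<le> metric_speed ?J y u" using elim by auto
        assume ball: "y u \<in> ball (y 0) r" "0 < \<phi> u" "\<phi> u \<le> \<phi> 0"
        have fu: "f (y u) = ereal (\<phi> u)" using u less_T by (intro f_y) auto
        have "ereal c \<le> ?A" using c by (simp add: admissible_def)
        also have "?A \<le> (slope f (y u))\<^sup>2 / f (y u)"
          unfolding alpha_def using ball by (intro Inf_lower) (auto intro!: exI[of _ "y u"] simp: fu f_x0 y0)
        also have "\<dots> = ereal ((metric_speed ?J y u)\<^sup>2 / \<phi> u)"
          using elim u ball by (simp add: fu power2_eq_square)
        finally show "c * \<phi> u \<le> (metric_speed ?J y u)\<^sup>2"
          using ball by (simp add: field_simps)
      qed
    qed
    note conf = confinement[OF c_pos \<open>0 < r\<close> sqrt_r[OF c] m(1) m2 m(3) m4 nonneg this st(1,2)]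
    show "dist (y t) (y s) \<le> 2 / sqrt c * (sqrt (\<phi> s) - sqrt (\<phi> t))"
      by (rule conf(1))
    show "\<phi> t \<le> exp (- (c * t)) * \<phi> 0" by (rule conf(2))
    show "y t \<in> closure (ball x0 r)" using conf(3) by (simp add: y0)
  qed
  obtain c0 where c0: "admissible c0"
  proof (cases ?A)
    case (real a)
    then show ?thesis using A_adm that by blast
  next
    case PInf
    then show ?thesis using inf_adm[OF PInf order_refl] that by blast
  qed (use A_pos in auto)
  have "\<exists>yT. (y \<longlongrightarrow> yT) F"
  proof (rule tendsto_of_dist_le_diff[OF _ _ \<open>0 < T\<close> F(2) F_ev])
    show "dist (y t) (y s) \<le> 2 / sqrt c0 * sqrt (\<phi> s) - 2 / sqrt c0 * sqrt (\<phi> t)"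
      if "0 \<le> s" "s \<le> t" "ereal t < T" for s t
      using est(1)[OF c0 that] by (simp add: right_diff_distrib)
    show "0 \<le> 2 / sqrt c0 * sqrt (\<phi> t)" if "0 \<le> t" "ereal t < T" for t
      using c0 \<phi>_nonneg[OF that] by (simp add: admissible_def)
  qed
  then obtain yT where yT: "(y \<longlongrightarrow> yT) F" ..
  have dist_yT: "dist (y s) yT \<le> r * exp (- (c * s / 2))"
    if c: "admissible c" and s: "0 \<le> s" "ereal s < T" for c s
  proof -
    have c_pos: "0 < c" using c by (simp add: admissible_def)
    have "dist yT (y s) \<le> 2 / sqrt c * sqrt (\<phi> s)"
    proof (rule tendsto_upperbound[OF tendsto_dist[OF yT tendsto_const]])
      show "eventually (\<lambda>t. dist (y t) (y s) \<le> 2 / sqrt c * sqrt (\<phi> s)) F"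
        using F_ev[OF s(2)]
      proof eventually_elim
        case (elim t)
        then have "dist (y t) (y s) \<le> 2 / sqrt c * (sqrt (\<phi> s) - sqrt (\<phi> t))"
          using s by (intro est(1)[OF c]) auto
        also have "\<dots> \<le> 2 / sqrt c * sqrt (\<phi> s)"
          using c_pos \<phi>_nonneg[of t] elim s by (intro mult_left_mono) auto
        finally show ?case .
      qed
    qed (rule F(2))
    also have "sqrt (\<phi> s) \<le> sqrt (exp (- (c * s)) * \<phi> 0)"
      using est(2)[OF c s(1) order_refl s(2)] by simp
    also have "\<dots> = exp (- (c * s / 2)) * sqrt (\<phi> 0)"
    proof -
      have "exp (- (c * s)) = (exp (- (c * s / 2)))\<^sup>2"
        by (simp add: exp_double[symmetric])
      then show ?thesis by (simp add: real_sqrt_mult)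
    qed
    also have "2 / sqrt c * (exp (- (c * s / 2)) * sqrt (\<phi> 0))
        = (2 / sqrt c * sqrt (\<phi> 0)) * exp (- (c * s / 2))" by simp
    also have "\<dots> \<le> r * exp (- (c * s / 2))"
      using sqrt_r[OF c] by (intro mult_right_mono) auto
    finally show ?thesis using c_pos by (simp add: dist_commute divide_right_mono)
  qed
  have yT_closure: "yT \<in> closure (ball x0 r)"
  proof (rule Lim_in_closed_set[OF closed_closure _ F(2) yT])
    have "ereal 0 < T" using \<open>0 < T\<close> by (simp add: zero_ereal_def)
    from F_ev[OF this] show "eventually (\<lambda>t. y t \<in> closure (ball x0 r)) F"
      by eventually_elim (use est(3)[OF c0] in \<open>auto intro: less_imp_le\<close>)
  qed
  have f_yT: "f yT \<le> ereal (\<phi> s)" if s: "0 \<le> s" "ereal s < T" for s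
  proof (rule lower_semicont_le_limit[OF \<open>lower_semicont f\<close> yT F(2)])
    show "eventually (\<lambda>t. f (y t) \<le> ereal (\<phi> s)) F"
      using F_ev[OF s(2)]
    proof eventually_elim
      case (elim t)
      then have "0 \<le> 2 / sqrt c0 * (sqrt (\<phi> s) - sqrt (\<phi> t))"
        using s by (intro order_trans[OF zero_le_dist est(1)[OF c0]]) auto
      moreover have "0 < 2 / sqrt c0" using c0 by (simp add: admissible_def)
      ultimately have "0 \<le> sqrt (\<phi> s) - sqrt (\<phi> t)" by (metis zero_le_mult_iff not_le)
      then have "\<phi> t \<le> \<phi> s" by simp
      then show ?case using elim s by (simp add: f_y)
    qed
  qed
  obtain g where g: "f yT = ereal g"
  proof -
    have "f yT \<le> ereal (\<phi> 0)" using f_yT[of 0] \<open>0 < T\<close> by (simp add: zero_ereal_def)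
    then show ?thesis using f_nonneg[of yT] that by (cases "f yT") auto
  qed
  have g_le: "g \<le> \<phi> s" if "0 \<le> s" "ereal s < T" for s
    using f_yT[OF that] by (simp add: g)
  \<comment> \<open>if \<open>alpha\<close> is infinite, arbitrarily large rates apply, and everything vanishes at positive times\<close>
  have decay_inf: "\<phi> s \<le> 0" "dist (y s) yT \<le> 0"
    if A: "?A = \<infinity>" and s: "0 < s" "ereal s < T" for s
  proof -
    show "\<phi> s \<le> 0"
    proof (rule nonpos_if_exp_bounds[OF s(1)])
      show "\<phi> s \<le> \<phi> 0 * exp (- (c * s))" if "max 1 (4 * \<phi> 0 / r\<^sup>2) \<le> c" for c
        using est(2)[OF inf_adm[OF A that], of s s] s by (simp add: mult.commute)
    qed
    have "0 < s / 2" using s by simp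
    then show "dist (y s) yT \<le> 0"
    proof (rule nonpos_if_exp_bounds)
      show "dist (y s) yT \<le> r * exp (- (c * (s / 2)))" if "max 1 (4 * \<phi> 0 / r\<^sup>2) \<le> c" for c
        using dist_yT[OF inf_adm[OF A that], of s] s by simp
    qed
  qed
  have final_value: "ereal g \<le> exp_ereal (- (?A * T)) * f x0"
  proof (cases ?A)
    case PInf
    obtain s where s: "0 < s" "ereal s < T"
      using ereal_dense2[OF \<open>0 < T\<close>] by (auto simp: zero_ereal_def)
    have "g \<le> 0" using g_le[of s] decay_inf(1)[OF PInf s] s by simp
    then have "ereal g \<le> 0" by (simp add: zero_ereal_def)
    also have "0 \<le> exp_ereal (- (?A * T)) * f x0"
      by (simp add: exp_ereal_nonneg f_nonneg)
    finally show ?thesis .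
  next
    case (real a)
    then have a: "0 < a" using A_pos by simp
    have "0 < T" by fact
    then have ev: "eventually (\<lambda>t. g \<le> exp (- (a * t)) * \<phi> 0) F"
      using F_ev[of 0]
      by (auto simp: zero_ereal_def elim!: eventually_mono
          intro: order_trans[OF g_le est(2)[OF A_adm[OF real]]])
    show ?thesis
    proof (cases T)
      case (real s)
      have "((\<lambda>t. exp (- (a * t)) * \<phi> 0) \<longlongrightarrow> exp (- (a * s)) * \<phi> 0) F"
        using F_real real by (auto intro!: tendsto_intros)
      from tendsto_lowerbound[OF this ev F(2)] show ?thesis
        by (simp add: real \<open>?A = ereal a\<close> f_x0)
    next
      case PInf
      have "g \<le> 0"
      proof (rule nonpos_if_exp_bounds[OF a])
        show "g \<le> \<phi> 0 * exp (- (t * a))" if "0 \<le> t" for t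
          using order_trans[OF g_le est(2)[OF A_adm[OF real], of t t]] that PInf
          by (simp add: mult.commute)
      qed
      then show ?thesis using a by (simp add: PInf real zero_ereal_def[symmetric])
    qed (use \<open>0 < T\<close> in auto)
  qed (use A_pos in auto)
  have at_s: "ereal (dist (y s) yT) \<le> ereal r * exp_ereal (- (?A * ereal s / 2)) \<and>
      f (y s) \<le> exp_ereal (- (?A * ereal s)) * f x0" if s: "0 \<le> s" "ereal s < T" for s
  proof (cases ?A)
    case (real a)
    have "exp_ereal (- (?A * ereal s / 2)) = ereal (exp (- (a * s / 2)))"
      by (simp add: real)
    then show ?thesis
      using dist_yT[OF A_adm[OF real] s] est(2)[OF A_adm[OF real] s(1) order_refl s(2)]
      by (simp add: f_y[OF s] f_x0 real)
  next
    case PInf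
    show ?thesis
    proof (cases "s = 0")
      case True
      then show ?thesis
        using dist_yT[OF c0 s] f_x0 y0 by (simp add: zero_ereal_def[symmetric])
    next
      case False
      with s have "0 < s" by simp
      have "f (y s) \<le> 0"
        using decay_inf(1)[OF PInf \<open>0 < s\<close> s(2)] by (simp add: f_y[OF s])
      with decay_inf(2)[OF PInf \<open>0 < s\<close> s(2)] \<open>0 < s\<close> show ?thesis
        by (simp add: PInf zero_ereal_def[symmetric])
    qed
  qed (use A_pos in auto)
  show ?thesis
  proof (intro exI[of _ yT] conjI allI impI)
    show "((\<lambda>t::ereal. y (real_of_ereal t)) \<longlongrightarrow> yT) (at_left T)"
      using yT by (simp add: F(1) filterlim_filtermap)
    fix t :: ereal
    assume t: "0 \<le> t \<and> t \<le> T"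
    have "extend_end T yT y t \<in> closure (ball x0 r) \<and>
        ereal (dist (extend_end T yT y t) yT) \<le> ereal r * exp_ereal (- (?A * t / 2)) \<and>
        f (extend_end T yT y t) \<le> exp_ereal (- (?A * t)) * f x0"
    proof (cases "t = T")
      case True
      then show ?thesis
        using yT_closure final_value \<open>0 < r\<close>
        by (simp add: extend_end_def g exp_ereal_nonneg zero_ereal_def[symmetric])
    next
      case False
      with t have "t < T" by (simp add: less_le)
      with t obtain s where s: "t = ereal s" "0 \<le> s" "ereal s < T"
        by (cases t) auto
      show ?thesis
        using False at_s[OF s(2,3)] est(3)[OF c0 s(2) order_refl s(3)]
        by (simp add: extend_end_def s(1))
    qed
    then show "extend_end T yT y t \<in> closure (ball x0 r)"
      "ereal (dist (extend_end T yT y t) yT) \<le> ereal r * exp_ereal (- (?A * t / 2))"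
      "f (extend_end T yT y t) \<le> exp_ereal (- (?A * t)) * f x0"
      by auto
  qed
qed

end
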